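(* Consider the following reconstruction problem. An undirected graph $G=(V,E,w)$ with $n=|V|$ vertices, $m=|E|$ edges and maximum degree $D$ (with $D\gg 1$ and $m/D=\omega(1)$ as $n\to\infty$) has a fixed edge structure, and its edge weights are independent and identically distributed random variables with Pareto cumulative distribution function $F(x)=1-x^{-\alpha}$ for $x\in[1,\infty)$, where $\alpha>0$ is a constant. The vertex set $V$ and the realized maximum edge weight $W_{\max}$ are known, but $E$ and $w$ are not. Using composite queries (any mixture of the queries $q_w(u,v,W_{\mathrm{thr}})$, $q_d(u,v,W_{\mathrm{thr}})$ and $q_c(u,S,W_{\mathrm{thr}})$ defined below), there is a randomized algorithm that reconstructs $E$ together with all edge weights with query complexity $\tilde{O}\left(\left(1+\frac{1}{\alpha}\log D\right)D^{3}n^{3/2}\right)$, where the bound is on the expected number of queries over the algorithm's internal randomness and holds asymptotically almost surely over the randomness of the edge weights.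
   Context: For a threshold $W_{\mathrm{thr}}\ge 1$, $G[w\ge W_{\mathrm{thr}}]$ denotes the spanning subgraph of $G$ on all of $V$ containing exactly the edges of weight at least $W_{\mathrm{thr}}$. The queries are: $q_w(u,v,W_{\mathrm{thr}})$ returns $w(u,v)$ if $uv$ is an edge of $G[w\ge W_{\mathrm{thr}}]$ and $0$ otherwise; $q_d(u,v,W_{\mathrm{thr}})$ returns the length (sum of weights) of a shortest weighted path between $u$ and $v$ in $G[w\ge W_{\mathrm{thr}}]$, and $+\infty$ if no path exists; for $u\in V$ and $S\subseteq V\setminus\{u\}$, $q_c(u,S,W_{\mathrm{thr}})$ returns $1$ if some $v\in S$ lies in the same connected component as $u$ in $G[w\ge W_{\mathrm{thr}}]$, and $0$ otherwise. Query complexity is the number of queries issued. $\tilde{O}(\cdot)$ hides polylogarithmic factors in $n$. "Asymptotically almost surely" means with probability tending to $1$ as $n\to\infty$; $\omega(1)$ denotes a quantity tending to infinity as $n\to\infty$. *)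

theory Defs
  imports "HOL-Probability.Probability"
begin

text \<open>Finite simple undirected graphs on a vertex set \<open>V\<close>; an edge \<open>uv\<close> is the two-element set
  \<open>{u, v}\<close>, and a weight function is only relevant on the edge set.\<close>

definition simple_graph :: "'v set \<Rightarrow> 'v set set \<Rightarrow> bool" where
  "simple_graph V E \<longleftrightarrow> finite V \<and> E \<subseteq> {{u, v} |u v. u \<in> V \<and> v \<in> V \<and> u \<noteq> v}"

definition vdegree :: "'v set set \<Rightarrow> 'v \<Rightarrow> nat" where
  "vdegree E v = card {e \<in> E. v \<in> e}"

definition max_degree :: "'v set \<Rightarrow> 'v set set \<Rightarrow> nat" where
  "max_degree V E = Max (vdegree E ` V)"

definition threshold_edges :: "'v set set \<Rightarrow> ('v set \<Rightarrow> real) \<Rightarrow> real \<Rightarrow> 'v set set" where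
  "threshold_edges E w t = {e \<in> E. t \<le> w e}"

fun path_edges :: "'v list \<Rightarrow> 'v set list" where
  "path_edges (x # y # zs) = {x, y} # path_edges (y # zs)"
| "path_edges _ = []"

definition is_path :: "'v set set \<Rightarrow> 'v \<Rightarrow> 'v \<Rightarrow> 'v list \<Rightarrow> bool" where
  "is_path F u v p \<longleftrightarrow>
     p \<noteq> [] \<and> hd p = u \<and> last p = v \<and> distinct p \<and> set (path_edges p) \<subseteq> F"

definition path_length :: "('v set \<Rightarrow> real) \<Rightarrow> 'v list \<Rightarrow> real" where
  "path_length w p = sum_list (map w (path_edges p))"

text \<open>In a finite graph there are only finitely many paths between two vertices, so the infimum
  is a minimum whenever there is a path; it is \<open>\<infinity>\<close> when there is none.\<close>

definition weighted_dist :: "'v set set \<Rightarrow> ('v set \<Rightarrow> real) \<Rightarrow> 'v \<Rightarrow> 'v \<Rightarrow> ereal" where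
  "weighted_dist F w u v = (INF p\<in>{p. is_path F u v p}. ereal (path_length w p))"

definition same_component :: "'v set set \<Rightarrow> 'v \<Rightarrow> 'v \<Rightarrow> bool" where
  "same_component F u v \<longleftrightarrow> (\<exists>p. is_path F u v p)"

datatype 'v query =
    Weight_Query 'v 'v real
  | Dist_Query 'v 'v real
  | Comp_Query 'v "'v set" real

fun legal_query :: "'v set \<Rightarrow> 'v query \<Rightarrow> bool" where
  "legal_query V (Weight_Query u v t) \<longleftrightarrow> u \<in> V \<and> v \<in> V \<and> 1 \<le> t"
| "legal_query V (Dist_Query u v t) \<longleftrightarrow> u \<in> V \<and> v \<in> V \<and> 1 \<le> t"
| "legal_query V (Comp_Query u S t) \<longleftrightarrow> u \<in> V \<and> S \<subseteq> V - {u} \<and> 1 \<le> t"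

fun answer :: "'v set set \<Rightarrow> ('v set \<Rightarrow> real) \<Rightarrow> 'v query \<Rightarrow> ereal" where
  "answer E w (Weight_Query u v t) =
     (if {u, v} \<in> threshold_edges E w t then ereal (w {u, v}) else 0)"
| "answer E w (Dist_Query u v t) = weighted_dist (threshold_edges E w t) w u v"
| "answer E w (Comp_Query u S t) =
     (if \<exists>v\<in>S. same_component (threshold_edges E w t) u v then 1 else 0)"

text \<open>Adaptive randomized query algorithms as (well-founded) decision trees: a node returns a
  result, asks a query and continues depending on the answer, or samples from a discrete
  distribution (the internal randomness) and continues depending on the sample.\<close>

datatype ('v, 'r) query_alg =
    Return 'r
  | Ask "'v query" "ereal \<Rightarrow> ('v, 'r) query_alg"
  | Sample "nat pmf" "nat \<Rightarrow> ('v, 'r) query_alg"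

primrec legal_alg :: "'v set \<Rightarrow> ('v, 'r) query_alg \<Rightarrow> bool" where
  "legal_alg V (Return r) \<longleftrightarrow> True"
| "legal_alg V (Ask q f) \<longleftrightarrow> legal_query V q \<and> (\<forall>a. legal_alg V (f a))"
| "legal_alg V (Sample p f) \<longleftrightarrow> (\<forall>x. legal_alg V (f x))"

text \<open>Joint distribution, over the internal randomness, of the returned result and the number of
  queries issued when the queries are answered by \<open>ans\<close>.\<close>

primrec run_alg :: "('v query \<Rightarrow> ereal) \<Rightarrow> ('v, 'r) query_alg \<Rightarrow> ('r \<times> nat) pmf" where
  "run_alg ans (Return r) = return_pmf (r, 0)"
| "run_alg ans (Ask q f) = map_pmf (\<lambda>(r, c). (r, Suc c)) (run_alg ans (f (ans q)))"
| "run_alg ans (Sample p f) = bind_pmf p (\<lambda>x. run_alg ans (f x))"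

definition expected_queries :: "('v query \<Rightarrow> ereal) \<Rightarrow> ('v, 'r) query_alg \<Rightarrow> ennreal" where
  "expected_queries ans A =
     (\<integral>\<^sup>+ x. of_nat (snd x) \<partial>measure_pmf (run_alg ans A))"

definition max_weight :: "'v set set \<Rightarrow> ('v set \<Rightarrow> real) \<Rightarrow> real" where
  "max_weight E w = Max (w ` E)"

definition pareto_cdf :: "real \<Rightarrow> real \<Rightarrow> real" where
  "pareto_cdf \<alpha> x = (if 1 \<le> x then 1 - x powr (- \<alpha>) else 0)"

definition iid_pareto_weights ::
    "'a measure \<Rightarrow> real \<Rightarrow> 'v set set \<Rightarrow> ('v set \<Rightarrow> 'a \<Rightarrow> real) \<Rightarrow> bool" where
  "iid_pareto_weights M \<alpha> E X \<longleftrightarrow>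
     prob_space M \<and>
     prob_space.indep_vars M (\<lambda>_. borel) X E \<and>
     (\<forall>e\<in>E. cdf (distr M borel (X e)) = pareto_cdf \<alpha>)"

text \<open>The event in question need not be known to be measurable, hence the measurable events
  \<open>A i\<close> contained in it; if it is measurable, this says that its probability tends to \<open>1\<close>.\<close>

definition asymptotically_almost_surely ::
    "(nat \<Rightarrow> 'a measure) \<Rightarrow> (nat \<Rightarrow> 'a \<Rightarrow> bool) \<Rightarrow> bool" where
  "asymptotically_almost_surely M P \<longleftrightarrow>
     (\<exists>A. (\<forall>i. A i \<in> sets (M i) \<and> (\<forall>\<omega>\<in>A i. P i \<omega>)) \<and>
          (\<lambda>i. measure (M i) (A i)) \<longlonglongrightarrow> 1)"

end

theory Submission imports Defs begin

text \<open>The distribution of the weights enters only through \<open>W\<^sub>m\<^sub>a\<^sub>x \<le> m powr (2 / \<alpha>)\<close>, which by a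
  union bound fails with probability at most \<open>1 / m\<close>; so \<open>O(1 + log n / \<alpha>)\<close> dyadic thresholds
  \<open>t = 2 ^ j\<close> cover all weights. For decreasing \<open>t\<close>, suppose that the edges of weight at least \<open>2 * t\<close>
  are known. In the graph of edges of weight at least \<open>t\<close> a path with two edges has length at least
  \<open>2 * t\<close>, so the new edges are exactly the pairs at distance less than \<open>2 * t\<close>.

  To find these pairs, choose about \<open>sqrt n\<close> centers \<open>A\<close> by the iterated sampling of Thorup and Zwick,
  such that every cluster \<open>{x. \<forall>a\<in>A. d b x < d a x}\<close> has about \<open>sqrt n\<close> elements. If \<open>a\<close> is the
  center nearest to a new edge \<open>u v\<close>, say to \<open>u\<close>, and \<open>b\<close> is the second vertex after \<open>a\<close> on a shortest
  path from \<open>a\<close> to \<open>u\<close>, then \<open>d b u \<le> d a u - 2 * t\<close>, hence both \<open>u\<close> and \<open>v\<close> lie in the cluster of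
  \<open>b\<close>. So it suffices to query all pairs inside the clusters of the \<open>O(D\<^sup>2)\<close> vertices at most two steps
  away from each center. A component without a center is itself contained in a cluster, and its
  vertices are enumerated by bisection with component queries.\<close>

section \<open>Expected cost of query algorithms\<close>

primrec bind_alg ::
    "('v, 'r) query_alg \<Rightarrow> ('r \<Rightarrow> ('v, 's) query_alg) \<Rightarrow> ('v, 's) query_alg" where
  "bind_alg (Return r) g = g r"
| "bind_alg (Ask q f) g = Ask q (\<lambda>a. bind_alg (f a) g)"
| "bind_alg (Sample p f) g = Sample p (\<lambda>x. bind_alg (f x) g)"

lemma legal_bind_alg:
  "legal_alg V A \<Longrightarrow> (\<And>r. legal_alg V (g r)) \<Longrightarrow> legal_alg V (bind_alg A g)"
  by (induction A) auto

lemma run_bind_alg: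
  "run_alg ans (bind_alg A g) =
     bind_pmf (run_alg ans A) (\<lambda>(r, c). map_pmf (\<lambda>(s, c'). (s, c + c')) (run_alg ans (g r)))"
proof (induction A)
  case (Return r)
  then show ?case by (simp add: bind_return_pmf case_prod_unfold)
next
  case (Ask q f)
  then show ?case
    by (simp add: map_bind_pmf bind_map_pmf case_prod_unfold pmf.map_comp o_def)
next
  case (Sample p f)
  then show ?case by (simp add: bind_assoc_pmf)
qed

text \<open>The cost of what follows a random step is a function of the random result, so the cost
  of a composition is an expectation of this form. Values in \<open>ennreal\<close> avoid
  integrability side conditions.\<close>

definition expect_result :: "('v query \<Rightarrow> ereal) \<Rightarrow> ('v, 'r) query_alg \<Rightarrow> ('r \<Rightarrow> ennreal) \<Rightarrow> ennreal"
  where "expect_result ans A \<phi> = (\<integral>\<^sup>+ x. \<phi> (fst x) \<partial>measure_pmf (run_alg ans A))"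

lemma expect_result_Return [simp]: "expect_result ans (Return r) \<phi> = \<phi> r"
  by (simp add: expect_result_def)

lemma expected_queries_Return [simp]: "expected_queries ans (Return r) = 0"
  by (simp add: expected_queries_def)

lemma expect_result_bind_alg:
  "expect_result ans (bind_alg A g) \<phi> = expect_result ans A (\<lambda>r. expect_result ans (g r) \<phi>)"
  by (simp add: expect_result_def run_bind_alg case_prod_unfold)

lemma expected_queries_bind_alg:
  "expected_queries ans (bind_alg A g) =
     expected_queries ans A + expect_result ans A (\<lambda>r. expected_queries ans (g r))"
  by (simp add: expect_result_def expected_queries_def run_bind_alg case_prod_unfold nn_integral_add)

lemma expect_result_add:
  "expect_result ans A (\<lambda>r. \<phi> r + \<psi> r) = expect_result ans A \<phi> + expect_result ans A \<psi>"
  by (simp add: expect_result_def nn_integral_add)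

lemma expect_result_cmult: "expect_result ans A (\<lambda>r. c * \<phi> r) = c * expect_result ans A \<phi>"
  by (simp add: expect_result_def nn_integral_cmult)

lemma expect_result_sum:
  "expect_result ans A (\<lambda>r. \<Sum>i\<in>I. \<phi> i r) = (\<Sum>i\<in>I. expect_result ans A (\<phi> i))"
  by (simp add: expect_result_def nn_integral_sum)

lemma expect_result_const [simp]: "expect_result ans A (\<lambda>r. c) = c"
  by (simp add: expect_result_def measure_pmf.emeasure_space_1[simplified])

lemma expect_result_mono:
  assumes "\<And>r. r \<in> fst ` set_pmf (run_alg ans A) \<Longrightarrow> \<phi> r \<le> \<psi> r"
  shows "expect_result ans A \<phi> \<le> expect_result ans A \<psi>"
  unfolding expect_result_def
  by (intro nn_integral_mono_AE) (auto simp: AE_measure_pmf_iff assms)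

lemma expect_result_cong:
  assumes "\<And>r. r \<in> fst ` set_pmf (run_alg ans A) \<Longrightarrow> \<phi> r = \<psi> r"
  shows "expect_result ans A \<phi> = expect_result ans A \<psi>"
  by (intro antisym expect_result_mono) (simp_all add: assms)

lemma results_bind_alg:
  "fst ` set_pmf (run_alg ans (bind_alg A g)) =
     (\<Union>r\<in>fst ` set_pmf (run_alg ans A). fst ` set_pmf (run_alg ans (g r)))"
  by (simp add: run_bind_alg case_prod_unfold image_UN image_image)

lemma results_bind_alg_subset:
  assumes "fst ` set_pmf (run_alg ans A) \<subseteq> {r}" "fst ` set_pmf (run_alg ans (g r)) \<subseteq> S"
  shows "fst ` set_pmf (run_alg ans (bind_alg A g)) \<subseteq> S"
  unfolding results_bind_alg
proof (rule UN_least)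
  fix s assume "s \<in> fst ` set_pmf (run_alg ans A)"
  with assms(1) have "s = r" by (meson singletonD subsetD)
  with assms(2) show "fst ` set_pmf (run_alg ans (g s)) \<subseteq> S" by simp
qed

lemma expect_result_unique:
  assumes "fst ` set_pmf (run_alg ans A) \<subseteq> {r}"
  shows "expect_result ans A \<phi> = \<phi> r"
proof -
  have "expect_result ans A \<phi> = expect_result ans A (\<lambda>_. \<phi> r)"
    using assms by (intro expect_result_cong) (metis singletonD subsetD)
  then show ?thesis by simp
qed

section \<open>Deterministic runs and batches of queries\<close>

definition computes :: "('v query \<Rightarrow> ereal) \<Rightarrow> ('v, 'r) query_alg \<Rightarrow> 'r \<Rightarrow> nat \<Rightarrow> bool" where
  "computes ans A r c \<longleftrightarrow> run_alg ans A = return_pmf (r, c)"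

lemma computes_Return: "computes ans (Return r) r 0"
  by (simp add: computes_def)

lemma computes_bind_alg:
  "computes ans A r c \<Longrightarrow> computes ans (g r) s c' \<Longrightarrow> computes ans (bind_alg A g) s (c + c')"
  by (simp add: computes_def run_bind_alg bind_return_pmf)

lemma computes_expect_result: "computes ans A r c \<Longrightarrow> expect_result ans A \<phi> = \<phi> r"
  by (simp add: computes_def expect_result_def)

lemma computes_expected_queries: "computes ans A r c \<Longrightarrow> expected_queries ans A = of_nat c"
  by (simp add: computes_def expected_queries_def)

lemma computes_results: "computes ans A r c \<Longrightarrow> fst ` set_pmf (run_alg ans A) = {r}"
  by (simp add: computes_def)

primrec gather_list :: "('k \<Rightarrow> ('v, 'r) query_alg) \<Rightarrow> 'k list \<Rightarrow> ('v, 'k \<Rightarrow> 'r) query_alg" where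
  "gather_list f [] = Return (\<lambda>_. undefined)"
| "gather_list f (x # xs) =
     bind_alg (f x) (\<lambda>r. bind_alg (gather_list f xs) (\<lambda>g. Return (g(x := r))))"

text \<open>Sets of keys carry no order, so an arbitrary enumeration is fixed to iterate over
  them.\<close>

definition list_of_set :: "'k set \<Rightarrow> 'k list" where
  "list_of_set P = (SOME xs. set xs = P \<and> distinct xs)"

lemma list_of_set: "finite P \<Longrightarrow> set (list_of_set P) = P \<and> distinct (list_of_set P)"
  unfolding list_of_set_def using finite_distinct_list[of P] by (rule someI_ex)

definition gather :: "('k \<Rightarrow> ('v, 'r) query_alg) \<Rightarrow> 'k set \<Rightarrow> ('v, 'k \<Rightarrow> 'r) query_alg" where
  "gather f P = gather_list f (list_of_set P)"

lemma legal_gather: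
  assumes "finite P" and "\<And>x. x \<in> P \<Longrightarrow> legal_alg V (f x)"
  shows "legal_alg V (gather f P)"
proof -
  have "(\<forall>x\<in>set xs. legal_alg V (f x)) \<Longrightarrow> legal_alg V (gather_list f xs)" for xs
    by (induction xs) (auto intro!: legal_bind_alg)
  then show ?thesis using assms list_of_set[of P] by (auto simp: gather_def)
qed

lemma computes_gather:
  fixes f :: "'k \<Rightarrow> ('v, 'r) query_alg"
  assumes "finite P" and "\<And>x. x \<in> P \<Longrightarrow> computes ans (f x) (r x) (c x)"
  shows "computes ans (gather f P) (\<lambda>x. if x \<in> P then r x else undefined) (\<Sum>x\<in>P. c x)"
proof -
  have "computes ans (gather_list f xs) (\<lambda>x. if x \<in> set xs then r x else undefined)
      (sum_list (map c xs))" if "\<forall>x\<in>set xs. computes ans (f x) (r x) (c x)" for xs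
    using that
  proof (induction xs)
    case Nil
    then show ?case using computes_Return by simp
  next
    case (Cons y ys)
    have "computes ans (Return ((\<lambda>x. if x \<in> set ys then r x else undefined)(y := r y)) ::
            ('v, 'k \<Rightarrow> 'r) query_alg)
        (\<lambda>x. if x \<in> set (y # ys) then r x else undefined) 0"
      by (auto simp: computes_def fun_eq_iff)
    then have "computes ans (gather_list f (y # ys))
        (\<lambda>x. if x \<in> set (y # ys) then r x else undefined) (c y + (sum_list (map c ys) + 0))"
      unfolding gather_list.simps using Cons by (intro computes_bind_alg) auto
    then show ?case by simp
  qed
  from this[of "list_of_set P"] assms list_of_set[of P] show ?thesis
    by (auto simp: gather_def sum_list_distinct_conv_sum_set)
qed

section \<open>Sampling of random subsets\<close>

primrec random_sublist :: "real \<Rightarrow> 'v list \<Rightarrow> ('v, 'v set) query_alg" where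
  "random_sublist q [] = Return {}"
| "random_sublist q (x # xs) =
     Sample (map_pmf of_bool (bernoulli_pmf q))
       (\<lambda>b. bind_alg (random_sublist q xs) (\<lambda>S. Return (if b = 1 then insert x S else S)))"

definition random_subset :: "real \<Rightarrow> 'v set \<Rightarrow> ('v, 'v set) query_alg" where
  "random_subset q V = random_sublist q (list_of_set V)"

lemma legal_random_subset: "legal_alg V (random_subset q U)"
proof -
  have "legal_alg V (random_sublist q xs)" for xs
    by (induction xs) (auto intro!: legal_bind_alg)
  then show ?thesis by (simp add: random_subset_def)
qed

lemma expect_result_Sample:
  "expect_result ans (Sample p f) \<phi> = (\<integral>\<^sup>+ x. expect_result ans (f x) \<phi> \<partial>measure_pmf p)"
  by (simp add: expect_result_def)

lemma expected_queries_Sample: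
  "expected_queries ans (Sample p f) = (\<integral>\<^sup>+ x. expected_queries ans (f x) \<partial>measure_pmf p)"
  by (simp add: expected_queries_def)

lemma expected_queries_random_subset [simp]: "expected_queries ans (random_subset q V) = 0"
proof -
  have "expected_queries ans (random_sublist q xs) = 0" for xs
    by (induction xs) (simp_all add: expected_queries_Sample expected_queries_bind_alg)
  then show ?thesis by (simp add: random_subset_def)
qed

lemma expect_random_sublist_Cons:
  assumes "0 \<le> q" "q \<le> 1"
  shows "expect_result ans (random_sublist q (x # xs)) \<phi> =
    ennreal q * expect_result ans (random_sublist q xs) (\<lambda>S. \<phi> (insert x S)) +
    ennreal (1 - q) * expect_result ans (random_sublist q xs) \<phi>"
  using assms by (simp add: expect_result_Sample expect_result_bind_alg mult.commute)

lemma results_Return: "fst ` set_pmf (run_alg ans (Return r)) = {r}"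
  by simp

lemma results_Sample:
  "fst ` set_pmf (run_alg ans (Sample p f)) = (\<Union>x\<in>set_pmf p. fst ` set_pmf (run_alg ans (f x)))"
  by auto

lemma results_random_subset:
  assumes "finite V" "S \<in> fst ` set_pmf (run_alg ans (random_subset q V))"
  shows "S \<subseteq> V"
proof -
  have "S \<subseteq> set xs" if "S \<in> fst ` set_pmf (run_alg ans (random_sublist q xs))" for xs S
    using that
  proof (induction xs arbitrary: S)
    case (Cons x xs)
    then obtain b :: nat and S' where "S' \<in> fst ` set_pmf (run_alg ans (random_sublist q xs))"
      "S = (if b = 1 then insert x S' else S')"
      unfolding random_sublist.simps results_Sample results_bind_alg results_Return by blast
    then show ?case using Cons.IH[of S'] by (auto split: if_splits)
  qed simp
  then show ?thesis using assms list_of_set[of V] unfolding random_subset_def by metis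
qed

text \<open>An inequality, so that \<open>v\<close> may also lie outside \<open>V\<close>, where it
  is never sampled.\<close>

lemma random_subset_mem:
  assumes "0 \<le> q" "q \<le> 1" "finite V"
  shows "expect_result ans (random_subset q V) (\<lambda>S. of_bool (v \<in> S)) \<le> ennreal q"
proof -
  have outside: "expect_result ans (random_sublist q xs) (\<lambda>S. of_bool (v \<in> S)) = 0"
    if "v \<notin> set xs" for xs
    using that assms by (induction xs) (auto simp: expect_random_sublist_Cons simp del: random_sublist.simps(2))
  have "expect_result ans (random_sublist q xs) (\<lambda>S. of_bool (v \<in> S)) \<le> ennreal q"
    if "distinct xs" for xs
    using that
  proof (induction xs)
    case (Cons x xs)
    show ?case
    proof (cases "v = x")
      case True
      then have "v \<notin> set xs" using Cons.prems by simp
      from outside[OF this] True show ?thesis using assms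
        by (simp add: expect_random_sublist_Cons del: random_sublist.simps(2))
    next
      case False
      then show ?thesis using assms Cons
        by (simp add: expect_random_sublist_Cons del: random_sublist.simps(2)
            flip: distrib_right ennreal_plus)
    qed
  qed simp
  then show ?thesis using assms list_of_set[of V] by (simp add: random_subset_def)
qed

text \<open>Elements are kept independently, so each element of \<open>C\<close> contributes a
  factor \<open>1 - q\<close>; as \<open>C\<close> lies in \<open>V\<close>, the exponent is its
  full cardinality.\<close>

lemma random_subset_disjoint:
  assumes "0 \<le> q" "q \<le> 1" "finite V" "C \<subseteq> V"
  shows "expect_result ans (random_subset q V) (\<lambda>S. of_bool (S \<inter> C = {})) =
           ennreal ((1 - q) ^ card C)"
proof -
  have "expect_result ans (random_sublist q xs) (\<lambda>S. of_bool (S \<inter> C = {})) =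
      ennreal ((1 - q) ^ card (C \<inter> set xs))" if "distinct xs" for xs
    using that
  proof (induction xs)
    case (Cons x xs)
    show ?case
    proof (cases "x \<in> C")
      case True
      then have "C \<inter> set (x # xs) = insert x (C \<inter> set xs)" by auto
      then show ?thesis using Cons assms True
        by (simp add: expect_random_sublist_Cons ennreal_mult del: random_sublist.simps(2))
    next
      case False
      then have "C \<inter> set (x # xs) = C \<inter> set xs" by auto
      then show ?thesis using Cons assms False
        by (simp add: expect_random_sublist_Cons del: random_sublist.simps(2) flip: distrib_right ennreal_plus)
    qed
  qed simp
  from this[of "list_of_set V"] show ?thesis using assms list_of_set[of V]
    by (simp add: random_subset_def Int_absorb2)
qed

lemma random_subset_sum:
  assumes "0 \<le> q" "q \<le> 1" "finite V" "finite U"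
  shows "expect_result ans (random_subset q V) (\<lambda>S. of_nat (card (S \<inter> U))) \<le> ennreal q * of_nat (card U)"
proof -
  have "of_nat (card (S \<inter> U)) = (\<Sum>v\<in>U. of_bool (v \<in> S) :: ennreal)" for S
    using assms(4) by (simp add: sum.If_cases of_bool_def Int_commute)
  then have "expect_result ans (random_subset q V) (\<lambda>S. of_nat (card (S \<inter> U))) =
      (\<Sum>v\<in>U. expect_result ans (random_subset q V) (\<lambda>S. of_bool (v \<in> S)))"
    by (simp add: expect_result_sum)
  also have "\<dots> \<le> (\<Sum>v\<in>U. ennreal q)"
    using assms by (intro sum_mono random_subset_mem)
  finally show ?thesis by (simp add: mult.commute)
qed

text \<open>Union bound: the indicator of a nonempty intersection is at most the size of the
  intersection.\<close>

lemma random_subset_meets: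
  assumes "0 \<le> q" "q \<le> 1" "finite V" "finite U"
  shows "expect_result ans (random_subset q V) (\<lambda>S. of_bool (S \<inter> U \<noteq> {})) \<le> ennreal q * of_nat (card U)"
proof -
  have "of_bool (S \<inter> U \<noteq> {}) \<le> (of_nat (card (S \<inter> U)) :: ennreal)" for S
  proof (cases "S \<inter> U = {}")
    case False
    then have "1 \<le> card (S \<inter> U)" using assms(4) by (simp add: Suc_le_eq card_gt_0_iff)
    then show ?thesis using False of_nat_mono[of 1 "card (S \<inter> U)", where 'a = ennreal] by simp
  qed simp
  then have "expect_result ans (random_subset q V) (\<lambda>S. of_bool (S \<inter> U \<noteq> {}))
      \<le> expect_result ans (random_subset q V) (\<lambda>S. of_nat (card (S \<inter> U)))"
    by (intro expect_result_mono)
  then show ?thesis using random_subset_sum[OF assms, of ans] by order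
qed

section \<open>Distances in threshold graphs\<close>

lemma path_edges_split: "path_edges (p @ x # q) = path_edges (p @ [x]) @ path_edges (x # q)"
  by (induction p rule: path_edges.induct) auto

lemma path_edges_snoc: "p \<noteq> [] \<Longrightarrow> path_edges (p @ [x]) = path_edges p @ [{last p, x}]"
  by (induction p rule: path_edges.induct) auto

lemma set_path_subset: "p \<noteq> [] \<Longrightarrow> set p \<subseteq> insert (hd p) (\<Union>(set (path_edges p)))"
  by (induction p rule: path_edges.induct) auto

lemma path_length_nonneg:
  "\<forall>e\<in>F. 0 \<le> w e \<Longrightarrow> set (path_edges p) \<subseteq> F \<Longrightarrow> 0 \<le> path_length w p"
  unfolding path_length_def by (rule sum_list_nonneg) auto

text \<open>Paths are simple, so if \<open>v\<close> already occurs on \<open>p\<close>, then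
  \<open>p\<close> is cut off at \<open>v\<close> instead of extended; nonnegative weights make the
  prefix no longer than \<open>p\<close>.\<close>

lemma extend_path:
  assumes p: "is_path F b u p" and uv: "{u, v} \<in> F" and pos: "\<forall>e\<in>F. 0 \<le> w e"
  shows "\<exists>q. is_path F b v q \<and> path_length w q \<le> path_length w p + w {u, v}"
proof (cases "v \<in> set p")
  case True
  then obtain p1 p2 where split: "p = p1 @ v # p2" by (meson split_list)
  then have edges: "path_edges p = path_edges (p1 @ [v]) @ path_edges (v # p2)"
    by (simp only: path_edges_split[of p1 v p2])
  have "path_length w (p1 @ [v]) \<le> path_length w p"
    using path_length_nonneg[OF pos, of "v # p2"] p
    by (auto simp: path_length_def edges is_path_def)
  moreover have "is_path F b v (p1 @ [v])"
    using p edges split by (auto simp: is_path_def hd_append split: if_splits)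
  ultimately show ?thesis using pos uv by (intro exI[of _ "p1 @ [v]"]) (auto intro: add_increasing2)
next
  case False
  then show ?thesis using p uv
    by (intro exI[of _ "p @ [v]"])
      (auto simp: is_path_def path_edges_snoc path_length_def)
qed

definition adjacent :: "'v set set \<Rightarrow> ('v \<times> 'v) set" where
  "adjacent F = {(x, y). {x, y} \<in> F}"

text \<open>With a reflexive transitive closure, transitivity is immediate, whereas joining two
  simple paths would require removing loops.\<close>

lemma same_component_iff: "same_component F u v \<longleftrightarrow> (u, v) \<in> (adjacent F)\<^sup>*"
proof
  assume "same_component F u v"
  then obtain p where "is_path F u v p" by (auto simp: same_component_def)
  then have "p \<noteq> []" "set (path_edges p) \<subseteq> F" "hd p = u" "last p = v" by (auto simp: is_path_def)
  then show "(u, v) \<in> (adjacent F)\<^sup>*"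
  proof (induction p arbitrary: u rule: path_edges.induct)
    case (1 x y zs)
    then have "(y, v) \<in> (adjacent F)\<^sup>*" "(x, y) \<in> adjacent F" by (auto simp: adjacent_def)
    then show ?case using 1 by (auto intro: converse_rtrancl_into_rtrancl)
  qed auto
next
  assume "(u, v) \<in> (adjacent F)\<^sup>*"
  then show "same_component F u v"
  proof induction
    case base
    have "is_path F u u [u]" by (simp add: is_path_def)
    then show ?case by (auto simp: same_component_def)
  next
    case (step y z)
    \<comment> \<open>Only the existence of a path matters, so the zero weight is used.\<close>
    then show ?case using extend_path[of F u y _ z "\<lambda>_. 0"]
      by (auto simp: same_component_def adjacent_def)
  qed
qed

lemma same_component_sym: "same_component F u v \<Longrightarrow> same_component F v u"
  unfolding same_component_iff
  by (metis (mono_tags, lifting) adjacent_def case_prodD case_prodI insert_commute mem_Collect_eq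
      symD symI sym_rtrancl)

lemma same_component_trans:
  "same_component F u v \<Longrightarrow> same_component F v x \<Longrightarrow> same_component F u x"
  unfolding same_component_iff by (rule rtrancl_trans)

lemma same_component_edge: "{u, v} \<in> F \<Longrightarrow> same_component F u v"
  unfolding same_component_iff adjacent_def by auto

lemma weighted_dist_le: "is_path F u v p \<Longrightarrow> weighted_dist F w u v \<le> ereal (path_length w p)"
  unfolding weighted_dist_def by (auto intro: INF_lower)

lemma weighted_dist_eq_infinity_iff: "weighted_dist F w u v = \<infinity> \<longleftrightarrow> \<not> same_component F u v"
proof
  assume "weighted_dist F w u v = \<infinity>"
  then show "\<not> same_component F u v"
    using weighted_dist_le[of F u v _ w] by (force simp: same_component_def)
next
  assume "\<not> same_component F u v"
  then have "{p. is_path F u v p} = {}" by (auto simp: same_component_def)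
  then show "weighted_dist F w u v = \<infinity>" by (simp add: weighted_dist_def top_ereal_def)
qed

text \<open>Simple paths are distinct lists over a finite set, so the infimum ranges over finitely
  many values.\<close>

lemma weighted_dist_attained:
  assumes "same_component F u v" "finite (\<Union>F)"
  obtains p where "is_path F u v p" "weighted_dist F w u v = ereal (path_length w p)"
proof -
  let ?P = "{p. is_path F u v p}"
  \<comment> \<open>The vertex \<open>u\<close> is inserted because of the trivial path
    \<open>[u]\<close>, whose vertex may be isolated in \<open>F\<close>.\<close>
  have "?P \<subseteq> {p. set p \<subseteq> insert u (\<Union>F) \<and> distinct p}"
  proof safe
    fix p x assume p: "is_path F u v p" and x: "x \<in> set p" "x \<notin> \<Union>F"
    then show "x = u" using set_path_subset[of p] unfolding is_path_def by blast
  qed (simp add: is_path_def)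
  then have fin: "finite ?P"
    using finite_subset_distinct[of "insert u (\<Union>F)"] assms(2) by (auto intro: finite_subset)
  have ne: "?P \<noteq> {}" using assms(1) by (auto simp: same_component_def)
  have "weighted_dist F w u v \<in> (\<lambda>p. ereal (path_length w p)) ` ?P"
    unfolding weighted_dist_def using fin ne by (subst Min_Inf[symmetric]) (auto intro!: Min_in)
  then show ?thesis using that by auto
qed

lemma weighted_dist_edge:
  assumes "{u, v} \<in> F" "finite (\<Union>F)" "\<forall>e\<in>F. 0 \<le> w e"
  shows "weighted_dist F w b v \<le> weighted_dist F w b u + ereal (w {u, v})"
proof (cases "same_component F b u")
  case True
  then obtain p where p: "is_path F b u p" "weighted_dist F w b u = ereal (path_length w p)"
    using weighted_dist_attained[OF True assms(2), of w] by blast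
  from extend_path[OF p(1) assms(1,3)] obtain q where
    q: "is_path F b v q" "path_length w q \<le> path_length w p + w {u, v}" by blast
  have "weighted_dist F w b v \<le> ereal (path_length w q)" by (rule weighted_dist_le[OF q(1)])
  also have "\<dots> \<le> weighted_dist F w b u + ereal (w {u, v})" using q(2) p(2) by simp
  finally show ?thesis .
next
  case False
  then have "weighted_dist F w b u = \<infinity>" by (simp add: weighted_dist_eq_infinity_iff)
  then show ?thesis by simp
qed

text \<open>Two edges already have length \<open>2 * t\<close>, so a shorter path is a single edge;
  \<open>u \<noteq> v\<close> excludes the trivial path. Edges of weight at least
  \<open>2 * t\<close> escape this test, which is why heavier layers are revealed first.\<close>

lemma weighted_dist_less_iff:
  assumes "u \<noteq> v" "0 < t" "\<forall>e\<in>F. t \<le> w e"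
  shows "weighted_dist F w u v < ereal (2 * t) \<longleftrightarrow> {u, v} \<in> F \<and> w {u, v} < 2 * t"
proof
  assume "weighted_dist F w u v < ereal (2 * t)"
  then obtain p where p: "is_path F u v p" "path_length w p < 2 * t"
    by (auto simp: weighted_dist_def INF_less_iff)
  obtain x p' where x: "p = x # p'" using p by (cases p) (auto simp: is_path_def)
  moreover obtain y p'' where y: "p' = y # p''" using p assms(1) x
    by (cases p') (auto simp: is_path_def)
  moreover have "p'' = []"
  proof (cases p'')
    case (Cons z q)
    have "0 \<le> path_length w (z # q)" using p(1) x y Cons assms(2,3)
      by (intro path_length_nonneg[of F]) (auto simp: is_path_def intro: order_trans[of 0 t])
    moreover have "t \<le> w {x, y}" "t \<le> w {y, z}" using p(1) x y Cons assms(3)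
      by (auto simp: is_path_def)
    ultimately have "2 * t \<le> path_length w p"
      using x y Cons by (auto simp: path_length_def)
    then show ?thesis using p(2) by simp
  qed simp
  ultimately show "{u, v} \<in> F \<and> w {u, v} < 2 * t"
    using p by (auto simp: is_path_def path_length_def)
next
  assume *: "{u, v} \<in> F \<and> w {u, v} < 2 * t"
  then have "is_path F u v [u, v]" using assms(1) by (simp add: is_path_def)
  from weighted_dist_le[OF this, of w] show "weighted_dist F w u v < ereal (2 * t)"
    using * by (auto simp: path_length_def elim!: order_le_less_trans)
qed

definition cluster :: "'v set \<Rightarrow> ('v \<Rightarrow> 'v \<Rightarrow> ereal) \<Rightarrow> 'v set \<Rightarrow> 'v \<Rightarrow> 'v set" where
  "cluster V d A b = {x \<in> V. \<forall>a\<in>A. d b x < d a x}"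

text \<open>The second half of \<open>nearest\<close> compares \<open>d a u\<close> with the
  distances from centers to the other endpoint \<open>v\<close>. It holds when \<open>u\<close> is
  the endpoint closer to the set of centers.\<close>

lemma light_edge_in_cluster:
  assumes F: "finite (\<Union>F)" "\<Union>F \<subseteq> V" and t: "0 < t" "\<forall>e\<in>F. t \<le> w e"
    and uv: "{u, v} \<in> F" "w {u, v} < 2 * t"
    and reach: "same_component F a u"
    and nearest: "\<forall>a'\<in>A. weighted_dist F w a u \<le> weighted_dist F w a' u"
      "\<forall>a'\<in>A. weighted_dist F w a u \<le> weighted_dist F w a' v"
  shows "u = a \<or> {a, u} \<in> F \<or>
    (\<exists>x b. {a, x} \<in> F \<and> {x, b} \<in> F \<and>
      u \<in> cluster V (weighted_dist F w) A b \<and> v \<in> cluster V (weighted_dist F w) A b)"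
proof -
  obtain p where p: "is_path F a u p" "weighted_dist F w a u = ereal (path_length w p)"
    using weighted_dist_attained[OF reach F(1), of w] by blast
  \<comment> \<open>The shortest path has no edge, one edge, or at least two;
    \<open>remdups_adj.cases\<close> serves only as the split into empty, singleton and longer
    lists.\<close>
  consider "p = [a]" | "p = [a, u]" | x b q where "p = a # x # b # q"
    using p(1) by (cases p rule: remdups_adj.cases)
      (auto simp: is_path_def neq_Nil_conv split: if_splits)
  then show ?thesis
  proof cases
    case 1
    then show ?thesis using p(1) by (auto simp: is_path_def)
  next
    case 2
    then show ?thesis using p(1) by (auto simp: is_path_def)
  next
    case 3
    have ax: "{a, x} \<in> F" "{x, b} \<in> F" using p(1) 3 by (auto simp: is_path_def)
    then have "2 * t \<le> w {a, x} + w {x, b}" using t(2) by (metis add_mono mult_2)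
    then have len: "path_length w (b # q) + 2 * t \<le> path_length w p"
      using 3 by (simp add: path_length_def)
    have "is_path F b u (b # q)" using p(1) 3 by (auto simp: is_path_def)
    from weighted_dist_le[OF this] have bu: "weighted_dist F w b u \<le> ereal (path_length w (b # q))" .
    have "weighted_dist F w b u < weighted_dist F w a u"
      using bu len t(1) p(2) by (auto elim!: order_le_less_trans)
    then have "u \<in> cluster V (weighted_dist F w) A b"
      using nearest(1) uv(1) F(2) by (auto simp: cluster_def intro: less_le_trans)
    \<comment> \<open>Dropping the first two edges saves at least \<open>2 * t\<close>, and crossing
      the edge to \<open>v\<close> costs strictly less than that.\<close>
    moreover have "weighted_dist F w b v < weighted_dist F w a u"
    proof -
      have "weighted_dist F w b v \<le> weighted_dist F w b u + ereal (w {u, v})"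
        using F(1) uv(1) t by (intro weighted_dist_edge) (auto intro: order_trans[of 0 t])
      also have "\<dots> \<le> ereal (path_length w (b # q)) + ereal (w {u, v})"
        using bu by (rule add_right_mono)
      also have "\<dots> < weighted_dist F w a u" using len uv(2) p(2) by simp
      finally show ?thesis .
    qed
    then have "v \<in> cluster V (weighted_dist F w) A b"
      using nearest(2) uv(1) F(2) by (auto simp: cluster_def intro: less_le_trans)
    ultimately show ?thesis using ax by blast
  qed
qed

section \<open>Random centers\<close>

text \<open>\<open>legal_alg\<close> quantifies over all conceivable answers, and \<open>P\<close>
  may be computed from earlier ones; the intersection with \<open>V \<times> V\<close> keeps every
  branch legal.\<close>

definition dist_table ::
    "'v set \<Rightarrow> real \<Rightarrow> ('v \<times> 'v) set \<Rightarrow> ('v, 'v \<times> 'v \<Rightarrow> ereal) query_alg" where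
  "dist_table V t P = gather (\<lambda>(x, y). Ask (Dist_Query x y t) Return) (P \<inter> V \<times> V)"

lemma legal_dist_table: "finite V \<Longrightarrow> 1 \<le> t \<Longrightarrow> legal_alg V (dist_table V t P)"
  unfolding dist_table_def by (intro legal_gather) auto

lemma computes_dist_table:
  assumes "finite V" "P \<subseteq> V \<times> V"
  shows "computes ans (dist_table V t P)
    (\<lambda>k. if k \<in> P then ans (Dist_Query (fst k) (snd k) t) else undefined) (card P)"
proof -
  have P: "P \<inter> V \<times> V = P" "finite P" using assms by (auto intro: finite_subset)
  have "computes ans (gather (\<lambda>(x, y). Ask (Dist_Query x y t) Return) P)
      (\<lambda>k. if k \<in> P then ans (Dist_Query (fst k) (snd k) t) else undefined) (\<Sum>k\<in>P. 1)"
    by (intro computes_gather P) (auto simp: computes_def)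
  then show ?thesis by (simp add: dist_table_def P)
qed

section \<open>Expected sizes of bunches and clusters\<close>

text \<open>Sorted by \<open>key\<close>, the element at position \<open>i\<close> has at least
  \<open>i\<close> elements with key at most its own, and powers of \<open>r\<close> decrease; ties
  only lower the sum. The induction removes an element of maximal key, whose rank is
  \<open>card W\<close>.\<close>

lemma sum_power_rank_le:
  fixes key :: "'b \<Rightarrow> 'c :: linorder" and r :: real
  assumes "finite W" "0 \<le> r" "r \<le> 1"
  shows "(\<Sum>b\<in>W. r ^ card {y \<in> W. key y \<le> key b}) \<le> (\<Sum>i=1..card W. r ^ i)"
  using assms(1)
proof (induction "card W" arbitrary: W)
  case (Suc n)
  then have ne: "W \<noteq> {}" by auto
  obtain m where m: "m \<in> W" "\<forall>y\<in>W. key y \<le> key m"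
    using Max_in[of "key ` W"] Max_ge[of "key ` W"] Suc.prems ne by fastforce
  have n: "n = card (W - {m})" using Suc m by simp
  have "{y \<in> W. key y \<le> key m} = W" using m by auto
  then have "(\<Sum>b\<in>W. r ^ card {y \<in> W. key y \<le> key b}) =
      r ^ card W + (\<Sum>b\<in>W - {m}. r ^ card {y \<in> W. key y \<le> key b})"
    using m Suc.prems by (simp add: sum.remove)
  also have "\<dots> \<le> r ^ card W + (\<Sum>b\<in>W - {m}. r ^ card {y \<in> W - {m}. key y \<le> key b})"
    using assms(2,3) Suc.prems
    by (intro add_left_mono sum_mono power_decreasing card_mono) auto
  also have "\<dots> \<le> r ^ card W + (\<Sum>i=1..n. r ^ i)"
    using Suc.hyps(1)[OF n] Suc.prems n by (intro add_left_mono) simp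
  also have "\<dots> = (\<Sum>i=1..card W. r ^ i)" by (simp flip: Suc.hyps(2))
  finally show ?case .
qed simp

lemma sum_power_le_inverse:
  fixes q :: real
  assumes "0 < q" "q \<le> 1"
  shows "(\<Sum>i=1..n. (1 - q) ^ i) \<le> 1 / q"
proof -
  have "(\<Sum>i=1..n. (1 - q) ^ i) \<le> (\<Sum>i<Suc n. (1 - q) ^ i)"
    using assms by (intro sum_mono2) auto
  also have "\<dots> = (1 - (1 - q) ^ Suc n) / q"
    using assms by (subst sum_gp_strict) auto
  also have "\<dots> \<le> 1 / q" using assms by (intro divide_right_mono) auto
  finally show ?thesis .
qed

text \<open>The vertex \<open>b\<close> of rank \<open>i\<close> in the order of distance from \<open>x\<close> counts only if none of the
  first \<open>i\<close> vertices is sampled, which has probability \<open>(1 - q) ^ i\<close>.\<close>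

lemma expected_bunch:
  assumes V: "finite V" "W \<subseteq> V" and q: "0 < q" "q \<le> 1"
  shows "expect_result ans (random_subset q V)
    (\<lambda>S. \<Sum>b\<in>W. of_bool (\<forall>a\<in>A \<union> S \<inter> W. d b x < (d a x :: ereal))) \<le> ennreal (1 / q)"
proof -
  have W: "finite W" using V finite_subset by auto
  have "expect_result ans (random_subset q V)
      (\<lambda>S. \<Sum>b\<in>W. of_bool (\<forall>a\<in>A \<union> S \<inter> W. d b x < d a x))
    \<le> expect_result ans (random_subset q V)
      (\<lambda>S. \<Sum>b\<in>W. of_bool (S \<inter> {y \<in> W. d y x \<le> d b x} = {}))"
    by (intro expect_result_mono sum_mono) (auto simp: not_le[symmetric])
  also have "\<dots> = (\<Sum>b\<in>W. ennreal ((1 - q) ^ card {y \<in> W. d y x \<le> d b x}))"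
    unfolding expect_result_sum using V q
    by (intro sum.cong refl random_subset_disjoint) auto
  also have "\<dots> = ennreal (\<Sum>b\<in>W. (1 - q) ^ card {y \<in> W. d y x \<le> d b x})"
    using q by (simp add: sum_ennreal)
  also have "\<dots> \<le> ennreal (1 / q)"
    using sum_power_rank_le[OF W, of "1 - q" "\<lambda>y. d y x"] sum_power_le_inverse[OF q, of "card W"] q
    by (intro ennreal_leI) simp
  finally show ?thesis .
qed

lemma cluster_subset: "cluster V d A b \<subseteq> V"
  by (auto simp: cluster_def)

lemma cluster_antimono: "A \<subseteq> B \<Longrightarrow> cluster V d B b \<subseteq> cluster V d A b"
  by (auto simp: cluster_def)

text \<open>Double counting: the clusters of the vertices in \<open>W\<close> have the same total
  size as the sets of those \<open>b\<close> in \<open>W\<close> whose cluster contains a given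
  \<open>x\<close>, and each such set has expected size at most \<open>1 / q\<close>. The
  independent probe \<open>T\<close> hits a cluster with probability at most \<open>p\<close> times
  its size.\<close>

lemma expected_survivors:
  assumes V: "finite V" "W \<subseteq> V" and q: "0 < q" "q \<le> 1" and p: "0 \<le> p" "p \<le> 1"
  shows "expect_result ans (random_subset q V) (\<lambda>S. expect_result ans (random_subset p V)
      (\<lambda>T. of_nat (card {b \<in> W. T \<inter> cluster V d (A \<union> S \<inter> W) b \<noteq> {}})))
    \<le> ennreal (p * real (card V) / q)"
proof -
  have W: "finite W" using V finite_subset by auto
  have inner: "expect_result ans (random_subset p V)
      (\<lambda>T. of_nat (card {b \<in> W. T \<inter> cluster V d (A \<union> S \<inter> W) b \<noteq> {}}))
    \<le> ennreal p * (\<Sum>x\<in>V. \<Sum>b\<in>W. of_bool (\<forall>a\<in>A \<union> S \<inter> W. d b x < d a x))" for S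
  proof -
    have "expect_result ans (random_subset p V)
        (\<lambda>T. of_nat (card {b \<in> W. T \<inter> cluster V d (A \<union> S \<inter> W) b \<noteq> {}}))
      = expect_result ans (random_subset p V)
        (\<lambda>T. \<Sum>b\<in>W. of_bool (T \<inter> cluster V d (A \<union> S \<inter> W) b \<noteq> {}))"
      using W by (simp add: of_bool_def sum.If_cases Int_def)
    also have "\<dots> \<le> (\<Sum>b\<in>W. ennreal p * of_nat (card (cluster V d (A \<union> S \<inter> W) b)))"
      unfolding expect_result_sum using V p finite_subset[OF cluster_subset]
      by (intro sum_mono random_subset_meets) auto
    also have "\<dots> = ennreal p * (\<Sum>b\<in>W. \<Sum>x\<in>V. of_bool (\<forall>a\<in>A \<union> S \<inter> W. d b x < d a x))"
      using V by (simp add: sum_distrib_left cluster_def of_bool_def sum.If_cases Int_def)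
    finally show ?thesis by (subst sum.swap)
  qed
  have "expect_result ans (random_subset q V) (\<lambda>S. expect_result ans (random_subset p V)
      (\<lambda>T. of_nat (card {b \<in> W. T \<inter> cluster V d (A \<union> S \<inter> W) b \<noteq> {}})))
    \<le> ennreal p * (\<Sum>x\<in>V. expect_result ans (random_subset q V)
        (\<lambda>S. \<Sum>b\<in>W. of_bool (\<forall>a\<in>A \<union> S \<inter> W. d b x < d a x)))"
    unfolding expect_result_sum[symmetric] expect_result_cmult[symmetric]
    by (intro expect_result_mono inner)
  also have "\<dots> \<le> ennreal p * (\<Sum>x\<in>V. ennreal (1 / q))"
    by (intro mult_left_mono sum_mono expected_bunch V q) auto
  also have "\<dots> = ennreal (p * real (card V) / q)"
    using p q by (simp add: ennreal_of_nat_eq_real_of_nat flip: ennreal_mult)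
  finally show ?thesis .
qed

text \<open>Invariant: every vertex outside \<open>W\<close> has, with high probability, a small cluster with respect
  to \<open>A\<close>. The sample \<open>T\<close> is a probe: a vertex leaves \<open>W\<close> when its cluster avoids \<open>T\<close>. The
  sampling rate for new centers doubles in each round while the expected size of \<open>W\<close> halves, so each
  round contributes equally many centers; the final rate is \<open>1\<close>.\<close>

primrec choose_centers ::
    "'v set \<Rightarrow> real \<Rightarrow> real \<Rightarrow> nat \<Rightarrow> 'v set \<Rightarrow> 'v set \<Rightarrow> ('v, 'v set) query_alg" where
  "choose_centers V t p 0 A W = Return (A \<union> W)"
| "choose_centers V t p (Suc k) A W =
     bind_alg (random_subset (1 / 2 ^ Suc k) V) (\<lambda>S.
     bind_alg (random_subset p V) (\<lambda>T.
     bind_alg (dist_table V t (V \<times> T)) (\<lambda>d.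
       choose_centers V t p k (A \<union> S \<inter> W)
         {b \<in> W. \<exists>x\<in>T. \<forall>a\<in>A \<union> S \<inter> W. d (b, x) < d (a, x)})))"

lemma legal_choose_centers:
  "finite V \<Longrightarrow> 1 \<le> t \<Longrightarrow> legal_alg V (choose_centers V t p k A W)"
  by (induction k arbitrary: A W)
    (auto intro!: legal_bind_alg legal_random_subset legal_dist_table)

lemma results_choose_centers:
  "A \<subseteq> V \<Longrightarrow> W \<subseteq> V \<Longrightarrow>
    \<forall>B \<in> fst ` set_pmf (run_alg ans (choose_centers V t p k A W)). B \<subseteq> V"
proof (induction k arbitrary: A W)
  case (Suc k)
  show ?case
    unfolding choose_centers.simps results_bind_alg
  proof (intro ballI, elim UN_E)
    fix B S T f
    assume "B \<in> fst ` set_pmf (run_alg ans (choose_centers V t p k (A \<union> S \<inter> W)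
         {b \<in> W. \<exists>x\<in>T. \<forall>a\<in>A \<union> S \<inter> W. f (b, x) < f (a, x)}))"
    moreover have "A \<union> S \<inter> W \<subseteq> V"
      "{b \<in> W. \<exists>x\<in>T. \<forall>a\<in>A \<union> S \<inter> W. f (b, x) < f (a, x)} \<subseteq> V"
      using Suc.prems by auto
    ultimately show "B \<subseteq> V" using Suc.IH by blast
  qed
qed simp

text \<open>The only queries of a round are the distances from all vertices to the probe, which has
  expected size at most \<open>p * card V\<close>.\<close>

lemma expected_queries_choose_centers:
  fixes p :: real
  assumes V: "finite V" and p: "0 \<le> p" "p \<le> 1" and "A \<subseteq> V" "W \<subseteq> V"
  shows "expected_queries ans (choose_centers V t p k A W) \<le> ennreal (k * p * real (card V) ^ 2)"
  using assms(4,5)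
proof (induction k arbitrary: A W)
  case (Suc k)
  let ?n = "card V"
  have "expected_queries ans (choose_centers V t p (Suc k) A W) \<le>
    expect_result ans (random_subset (1 / 2 ^ Suc k) V) (\<lambda>S.
    expect_result ans (random_subset p V) (\<lambda>T.
      of_nat ?n * of_nat (card (T \<inter> V)) + ennreal (k * p * real ?n ^ 2)))"
    unfolding choose_centers.simps expected_queries_bind_alg expected_queries_random_subset add_0
  proof (intro expect_result_mono)
    fix S T
    assume "T \<in> fst ` set_pmf (run_alg ans (random_subset p V))"
    then have T: "T \<subseteq> V" using results_random_subset V by blast
    then have "V \<times> T \<subseteq> V \<times> V" by auto
    note comp = computes_dist_table[OF V this, of ans t]
    have IH: "expected_queries ans (choose_centers V t p k (A \<union> S \<inter> W)
        {b \<in> W. \<exists>x\<in>T. \<forall>a\<in>A \<union> S \<inter> W. f (b, x) < f (a, x)}) \<le> ennreal (k * p * real ?n ^ 2)" for f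
      using Suc.prems by (intro Suc.IH) auto
    show "expected_queries ans (dist_table V t (V \<times> T)) +
       expect_result ans (dist_table V t (V \<times> T))
        (\<lambda>f. expected_queries ans (choose_centers V t p k (A \<union> S \<inter> W)
               {b \<in> W. \<exists>x\<in>T. \<forall>a\<in>A \<union> S \<inter> W. f (b, x) < f (a, x)}))
      \<le> of_nat ?n * of_nat (card (T \<inter> V)) + ennreal (k * p * real ?n ^ 2)"
      using T unfolding computes_expected_queries[OF comp] computes_expect_result[OF comp]
      by (intro add_mono IH) (simp add: card_cartesian_product Int_absorb2)
  qed
  also have "\<dots> \<le> of_nat ?n * (ennreal p * of_nat ?n) + ennreal (k * p * real ?n ^ 2)"
    unfolding expect_result_add expect_result_cmult expect_result_const using V p
    by (intro add_right_mono mult_left_mono random_subset_sum) auto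
  also have "\<dots> = ennreal (Suc k * p * real ?n ^ 2)"
    using p by (simp add: ennreal_of_nat_eq_real_of_nat power2_eq_square algebra_simps
        flip: ennreal_mult ennreal_plus)
  finally show ?case .
qed simp

section \<open>Number and quality of the random centers\<close>

context
  fixes V :: "'v set" and t p :: real and ans :: "'v query \<Rightarrow> ereal" and d
  assumes V: "finite V" and p: "0 \<le> p" "p \<le> 1" and d_eq: "d = (\<lambda>x y. ans (Dist_Query x y t))"
begin

text \<open>The table is \<open>undefined\<close> outside \<open>V \<times> T\<close>, but the test
  reads only entries from a vertex of \<open>V\<close> to a probe in \<open>T\<close>.\<close>

lemma survivors_eq:
  assumes "T \<subseteq> V" "A \<subseteq> V" "W \<subseteq> V"
    and tab: "tab = (\<lambda>k. if k \<in> V \<times> T then ans (Dist_Query (fst k) (snd k) t) else undefined)"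
  shows "{b \<in> W. \<exists>x\<in>T. \<forall>a\<in>A. tab (b, x) < tab (a, x)} =
    {b \<in> W. T \<inter> cluster V d A b \<noteq> {}}"
proof -
  have "(\<exists>x\<in>T. \<forall>a\<in>A. tab (b, x) < tab (a, x)) \<longleftrightarrow> T \<inter> cluster V d A b \<noteq> {}" if "b \<in> W" for b
  proof -
    have "tab (y, x) = d y x" if "y \<in> V" "x \<in> T" for x y
      using that by (simp add: tab d_eq)
    then have "(\<forall>a\<in>A. tab (b, x) < tab (a, x)) \<longleftrightarrow> (\<forall>a\<in>A. d b x < d a x)" if "x \<in> T" for x
      using that assms \<open>b \<in> W\<close> by (metis (no_types, lifting) subsetD)
    then show ?thesis using assms(1) by (auto simp: cluster_def)
  qed
  then show ?thesis by blast
qed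

text \<open>Replacing the queried table by the true distances \<open>d\<close> leaves a purely
  probabilistic recursion.\<close>

lemma expect_choose_centers_Suc:
  assumes "A \<subseteq> V" "W \<subseteq> V"
  shows "expect_result ans (choose_centers V t p (Suc k) A W) \<phi> =
    expect_result ans (random_subset (1 / 2 ^ Suc k) V) (\<lambda>S.
    expect_result ans (random_subset p V) (\<lambda>T.
    expect_result ans (choose_centers V t p k (A \<union> S \<inter> W)
      {b \<in> W. T \<inter> cluster V d (A \<union> S \<inter> W) b \<noteq> {}}) \<phi>))"
  unfolding choose_centers.simps expect_result_bind_alg
proof (intro expect_result_cong)
  fix S T
  assume "T \<in> fst ` set_pmf (run_alg ans (random_subset p V))"
  then have T: "T \<subseteq> V" using results_random_subset V by blast
  then have "V \<times> T \<subseteq> V \<times> V" by auto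
  note table = computes_expect_result[OF computes_dist_table[OF V this]]
  have A: "A \<union> S \<inter> W \<subseteq> V" using assms by auto
  show "expect_result ans (dist_table V t (V \<times> T)) (\<lambda>d. expect_result ans
      (choose_centers V t p k (A \<union> S \<inter> W)
        {b \<in> W. \<exists>x\<in>T. \<forall>a\<in>A \<union> S \<inter> W. d (b, x) < d (a, x)}) \<phi>) =
    expect_result ans (choose_centers V t p k (A \<union> S \<inter> W)
      {b \<in> W. T \<inter> cluster V d (A \<union> S \<inter> W) b \<noteq> {}}) \<phi>"
    by (simp only: table survivors_eq[OF T A assms(2) refl])
qed

text \<open>A vertex of \<open>W\<close> with \<open>k\<close> rounds left is charged
  \<open>1 / 2 ^ k\<close>. In a round at rate \<open>1 / 2 ^ Suc k\<close> the new centers number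
  at most \<open>card W / 2 ^ Suc k\<close> on average, and at most
  \<open>2 ^ Suc k * p * card V\<close> vertices survive, whose later charge is
  \<open>2 * p * card V\<close>.\<close>

lemma expected_card_choose_centers:
  assumes "A \<subseteq> V" "W \<subseteq> V"
  shows "expect_result ans (choose_centers V t p k A W) (\<lambda>B. of_nat (card B)) \<le>
    ennreal (card A + card W / 2 ^ k + 2 * real k * p * card V)"
  using assms
proof (induction k arbitrary: A W)
  case 0
  have "card (A \<union> W) \<le> card A + card W" by (rule card_Un_le)
  then show ?case
    by (simp add: ennreal_of_nat_eq_real_of_nat ennreal_leI flip: ennreal_plus)
next
  case (Suc k)
  let ?n = "card V" and ?q = "1 / 2 ^ Suc k :: real"
  let ?W = "\<lambda>S T. {b \<in> W. T \<inter> cluster V d (A \<union> S \<inter> W) b \<noteq> {}}"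
  have W: "finite W" using Suc.prems V finite_subset by auto
  have q: "0 < ?q" "?q \<le> 1" by (simp_all add: divide_le_eq_1 one_le_power del: power_Suc)
  have "expect_result ans (choose_centers V t p (Suc k) A W) (\<lambda>B. of_nat (card B)) \<le>
    expect_result ans (random_subset ?q V) (\<lambda>S. expect_result ans (random_subset p V) (\<lambda>T.
      ennreal (card A + 2 * real k * p * ?n) + of_nat (card (S \<inter> W)) +
      ennreal (1 / 2 ^ k) * of_nat (card (?W S T))))"
    unfolding expect_choose_centers_Suc[OF Suc.prems]
  proof (intro expect_result_mono)
    fix S T
    have "expect_result ans (choose_centers V t p k (A \<union> S \<inter> W) (?W S T)) (\<lambda>B. of_nat (card B))
      \<le> ennreal (card (A \<union> S \<inter> W) + card (?W S T) / 2 ^ k + 2 * real k * p * ?n)"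
      using Suc.prems by (intro Suc.IH) auto
    also have "\<dots> \<le> ennreal (card A + 2 * real k * p * ?n + card (S \<inter> W) + 1 / 2 ^ k * card (?W S T))"
      using card_Un_le[of A "S \<inter> W"] by (intro ennreal_leI) simp
    also have "\<dots> = ennreal (card A + 2 * real k * p * ?n) + of_nat (card (S \<inter> W)) +
      ennreal (1 / 2 ^ k) * of_nat (card (?W S T))"
      using p by (simp add: ennreal_of_nat_eq_real_of_nat flip: ennreal_mult ennreal_plus)
    finally show "expect_result ans (choose_centers V t p k (A \<union> S \<inter> W) (?W S T)) (\<lambda>B. of_nat (card B)) \<le> \<dots>" .
  qed
  also have "\<dots> \<le> ennreal (card A + 2 * real k * p * ?n) + ennreal ?q * of_nat (card W) +
      ennreal (1 / 2 ^ k) * ennreal (p * ?n / ?q)"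
    unfolding expect_result_add expect_result_cmult expect_result_const
    using V p q W Suc.prems
    by (intro add_mono mult_left_mono random_subset_sum expected_survivors) auto
  also have "\<dots> = ennreal (card A + card W / 2 ^ Suc k + 2 * real (Suc k) * p * ?n)"
    using p by (simp add: ennreal_of_nat_eq_real_of_nat field_simps flip: ennreal_mult ennreal_plus)
  finally show ?case .
qed

text \<open>Adding centers only shrinks clusters. So a final cluster larger than \<open>K\<close>
  was already that large when its vertex left \<open>W\<close>, which requires the probe to miss
  more than \<open>K\<close> vertices; the bound sums this over the rounds.\<close>

lemma large_cluster_choose_centers:
  assumes "A \<subseteq> V" "W \<subseteq> V"
  shows "expect_result ans (choose_centers V t p k A W) (\<lambda>B. of_bool (K < card (cluster V d B b))) \<le>
    of_bool (b \<notin> W \<and> K < card (cluster V d A b)) + ennreal (k * (1 - p) ^ K)"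
  using assms
proof (induction k arbitrary: A W)
  case 0
  show ?case
  proof (cases "b \<in> W")
    case True
    \<comment> \<open>A center has an empty cluster, since it would have to be strictly closer than
      itself.\<close>
    then have "cluster V d (A \<union> W) b = {}" by (auto simp: cluster_def)
    then show ?thesis by simp
  next
    case False
    have "card (cluster V d (A \<union> W) b) \<le> card (cluster V d A b)"
      using V by (intro card_mono cluster_antimono) (auto intro: finite_subset[OF cluster_subset])
    then show ?thesis using False by auto
  qed
next
  case (Suc k)
  let ?q = "1 / 2 ^ Suc k :: real"
  let ?A = "\<lambda>S. A \<union> S \<inter> W"
  let ?W = "\<lambda>S T. {b \<in> W. T \<inter> cluster V d (?A S) b \<noteq> {}}"
  have fin: "finite (cluster V d B b)" for B b
    using V by (auto intro: finite_subset[OF cluster_subset])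
  \<comment> \<open>Either \<open>b\<close> is dropped in this round although its cluster is large,
    so the probe missed it, or \<open>b\<close> was dropped before, and its cluster was large with
    respect to \<open>A\<close> already.\<close>
  have dropped: "expect_result ans (random_subset p V)
      (\<lambda>T. of_bool (b \<notin> ?W S T \<and> K < card (cluster V d (?A S) b)))
    \<le> of_bool (b \<notin> W \<and> K < card (cluster V d A b)) + ennreal ((1 - p) ^ K)" for S
  proof (cases "b \<in> W \<and> K < card (cluster V d (?A S) b)")
    case True
    then have "expect_result ans (random_subset p V)
        (\<lambda>T. of_bool (b \<notin> ?W S T \<and> K < card (cluster V d (?A S) b)))
      = ennreal ((1 - p) ^ card (cluster V d (?A S) b))"
      using random_subset_disjoint[OF p V cluster_subset, of ans d "?A S" b] by simp
    also have "\<dots> \<le> ennreal ((1 - p) ^ K)"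
      using True p by (intro ennreal_leI power_decreasing) auto
    finally show ?thesis using True by simp
  next
    case False
    have "card (cluster V d (?A S) b) \<le> card (cluster V d A b)"
      by (intro card_mono cluster_antimono fin) auto
    then have "(of_bool (b \<notin> ?W S T \<and> K < card (cluster V d (?A S) b)) :: ennreal)
        \<le> of_bool (b \<notin> W \<and> K < card (cluster V d A b))" for T
      using False by auto
    then have "expect_result ans (random_subset p V)
        (\<lambda>T. of_bool (b \<notin> ?W S T \<and> K < card (cluster V d (?A S) b)))
      \<le> expect_result ans (random_subset p V) (\<lambda>T. of_bool (b \<notin> W \<and> K < card (cluster V d A b)))"
      by (intro expect_result_mono)
    then show ?thesis by (simp add: add_increasing2)
  qed
  have "expect_result ans (choose_centers V t p (Suc k) A W) (\<lambda>B. of_bool (K < card (cluster V d B b))) \<le>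
    expect_result ans (random_subset ?q V) (\<lambda>S. expect_result ans (random_subset p V) (\<lambda>T.
      of_bool (b \<notin> ?W S T \<and> K < card (cluster V d (?A S) b)) + ennreal (k * (1 - p) ^ K)))"
    unfolding expect_choose_centers_Suc[OF Suc.prems] using Suc.prems
    by (intro expect_result_mono Suc.IH) auto
  also have "\<dots> \<le> of_bool (b \<notin> W \<and> K < card (cluster V d A b)) + ennreal ((1 - p) ^ K) +
      ennreal (k * (1 - p) ^ K)"
    unfolding expect_result_add expect_result_const
    by (intro add_right_mono order_trans[OF expect_result_mono[OF dropped]]) simp
  also have "\<dots> = of_bool (b \<notin> W \<and> K < card (cluster V d A b)) + ennreal (Suc k * (1 - p) ^ K)"
    using p by (simp add: add.assoc algebra_simps flip: ennreal_plus)
  finally show ?case .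
qed

end

section \<open>Finding the light edges\<close>

text \<open>A negative answer discards the whole list. The result is meant for lists of length at
  most \<open>2 ^ k\<close>; at \<open>k = 0\<close> a single candidate is decided by the answer
  itself.\<close>

primrec component_list :: "nat \<Rightarrow> 'v \<Rightarrow> real \<Rightarrow> 'v list \<Rightarrow> ('v, 'v set) query_alg" where
  "component_list 0 x t ys =
     Ask (Comp_Query x (set ys) t) (\<lambda>a. Return (if a = 1 then set ys else {}))"
| "component_list (Suc k) x t ys =
     Ask (Comp_Query x (set ys) t) (\<lambda>a. if a = 1 then
       bind_alg (component_list k x t (take (2 ^ k) ys)) (\<lambda>S.
       bind_alg (component_list k x t (drop (2 ^ k) ys)) (\<lambda>S'. Return (S \<union> S')))
     else Return {})"

lemma legal_component_list:
  "x \<in> V \<Longrightarrow> 1 \<le> t \<Longrightarrow> set ys \<subseteq> V - {x} \<Longrightarrow> legal_alg V (component_list k x t ys)"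
proof (induction k arbitrary: ys)
  case (Suc k)
  have "set (take (2 ^ k) ys) \<subseteq> V - {x}" "set (drop (2 ^ k) ys) \<subseteq> V - {x}"
    using Suc.prems(3) set_take_subset set_drop_subset by fastforce+
  then show ?case using Suc by (auto intro!: legal_bind_alg)
qed auto

text \<open>On each level at most one sublist per vertex found gets a positive answer and spawns two
  further queries; the summand 1 is the query at the root.\<close>

lemma computes_component_list:
  fixes E :: "'v set set" and w :: "'v set \<Rightarrow> real" and t :: real and x :: 'v
  assumes "length ys \<le> 2 ^ k" "distinct ys"
  defines "C \<equiv> \<lambda>ys. {y \<in> set ys. same_component (threshold_edges E w t) x y}"
  shows "\<exists>c \<le> 1 + 2 * k * card (C ys). computes (answer E w) (component_list k x t ys) (C ys) c"
  using assms(1,2)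
proof (induction k arbitrary: ys)
  case 0
  then consider "ys = []" | y where "ys = [y]" by (cases ys) auto
  then show ?case
  proof cases
    case 1
    then show ?thesis by (auto intro!: exI[of _ 1] simp: computes_def C_def)
  next
    case 2
    then show ?thesis by (auto intro!: exI[of _ 1] simp: computes_def C_def)
  qed
next
  case (Suc k)
  let ?ys1 = "take (2 ^ k) ys" and ?ys2 = "drop (2 ^ k) ys"
  show ?case
  proof (cases "C ys = {}")
    case True
    then have "computes (answer E w) (component_list (Suc k) x t ys) (C ys) 1"
      by (auto simp: computes_def C_def)
    then show ?thesis by (auto intro!: exI[of _ 1])
  next
    case False
    have set_ys: "set ys = set ?ys1 \<union> set ?ys2" by (metis append_take_drop_id set_append)
    then have C: "C ys = C ?ys1 \<union> C ?ys2" by (auto simp: C_def)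
    have "C ?ys1 \<inter> C ?ys2 = {}"
      using set_take_disj_set_drop_if_distinct[OF Suc.prems(2), of "2 ^ k" "2 ^ k"]
      by (auto simp: C_def)
    then have card: "card (C ys) = card (C ?ys1) + card (C ?ys2)"
      unfolding C by (intro card_Un_disjoint) (auto simp: C_def)
    from Suc.IH[of ?ys1] Suc.prems obtain c1 where c1: "c1 \<le> 1 + 2 * k * card (C ?ys1)"
      "computes (answer E w) (component_list k x t ?ys1) (C ?ys1) c1" by auto
    have "length ?ys2 \<le> 2 ^ k" using Suc.prems(1) by simp
    from Suc.IH[OF this] Suc.prems obtain c2 where c2: "c2 \<le> 1 + 2 * k * card (C ?ys2)"
      "computes (answer E w) (component_list k x t ?ys2) (C ?ys2) c2" by auto
    have "computes (answer E w) (bind_alg (component_list k x t ?ys1) (\<lambda>S.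
       bind_alg (component_list k x t ?ys2) (\<lambda>S'. Return (S \<union> S')))) (C ys) (c1 + (c2 + 0))"
      unfolding C by (intro computes_bind_alg[OF c1(2)] computes_bind_alg[OF c2(2)] computes_Return)
    moreover have "answer E w (Comp_Query x (set ys) t) = 1" using False by (auto simp: C_def)
    ultimately have "computes (answer E w) (component_list (Suc k) x t ys) (C ys)
        (Suc (c1 + (c2 + 0)))"
      by (auto simp: computes_def simp del: answer.simps)
    \<comment> \<open>At least one vertex is found, which pays for the two root queries of the
      halves.\<close>
    moreover have "1 \<le> card (C ys)" using False by (simp add: Suc_le_eq card_gt_0_iff C_def)
    then have "Suc (c1 + (c2 + 0)) \<le> 1 + 2 * Suc k * card (C ys)"
      using c1(1) c2(1) card by (simp add: algebra_simps)
    ultimately show ?thesis by blast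
  qed
qed

section \<open>Covering the light edges by candidate pairs\<close>

text \<open>The closed neighborhood of \<open>U\<close> in the graph of edges of weight at least
  \<open>t\<close>, in terms of observable data: heavy edges are read from \<open>H\<close>, light
  ones are recognized by a distance below \<open>2 * t\<close>.\<close>

definition close_nbhd ::
    "'v set \<Rightarrow> real \<Rightarrow> 'v set set \<Rightarrow> ('v \<times> 'v \<Rightarrow> ereal) \<Rightarrow> 'v set \<Rightarrow> 'v set" where
  "close_nbhd V t H d U =
     U \<union> {y \<in> V. \<exists>x\<in>U. {x, y} \<in> H \<or> x \<noteq> y \<and> d (x, y) < ereal (2 * t)}"

text \<open>Here \<open>H\<close> is the set of edges of weight at least \<open>2 * t\<close>, already known from the previous
  layers, \<open>A\<close> is the set of centers, and \<open>Z\<close> consists of the components without a center, which are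
  too numerous for distance queries and are enumerated by component queries instead.\<close>

definition add_light_edges ::
    "'v set \<Rightarrow> real \<Rightarrow> nat \<Rightarrow> 'v set set \<Rightarrow> 'v set \<Rightarrow> ('v, 'v set set) query_alg" where
  "add_light_edges V t k H A =
     bind_alg (dist_table V t (A \<times> V)) (\<lambda>d1.
     let N1 = close_nbhd V t H d1 A; Z = {x \<in> V. \<forall>a\<in>A. d1 (a, x) = \<infinity>} in
     bind_alg (dist_table V t (N1 \<times> V)) (\<lambda>d2.
     let N2 = close_nbhd V t H d2 N1 in
     bind_alg (dist_table V t (N2 \<times> V)) (\<lambda>d3.
     bind_alg (gather (\<lambda>x. component_list k x t (list_of_set (V - {x}))) Z) (\<lambda>comp.
     let P = N2 \<times> V \<union> (\<Union>b\<in>N2. cluster V (curry d3) A b \<times> cluster V (curry d3) A b) \<union> Sigma Z comp in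
     bind_alg (dist_table V t P) (\<lambda>d.
     Return (H \<union> {{x, y} |x y. (x, y) \<in> P \<and> x \<noteq> y \<and> d (x, y) < ereal (2 * t)}))))))"

lemma legal_add_light_edges:
  assumes "finite V" "1 \<le> t"
  shows "legal_alg V (add_light_edges V t k H A)"
  unfolding add_light_edges_def Let_def using assms list_of_set[of "V - {_}"]
  by (intro legal_bind_alg legal_dist_table legal_gather legal_component_list) auto

context
  fixes V :: "'v set" and E :: "'v set set" and w :: "'v set \<Rightarrow> real" and t :: real
    and F H d
  assumes graph: "simple_graph V E" and t: "1 \<le> t"
    and F_def: "F = threshold_edges E w t" and H_def: "H = threshold_edges E w (2 * t)"
    and d_def: "d = weighted_dist F w"
begin

lemma finite_vertices: "finite V"
  using graph by (simp add: simple_graph_def)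

lemma F_edges: "{x, y} \<in> F \<Longrightarrow> x \<in> V \<and> y \<in> V \<and> x \<noteq> y"
  using graph unfolding F_def threshold_edges_def simple_graph_def
  by (auto simp: doubleton_eq_iff)

lemma Union_F_subset: "\<Union>F \<subseteq> V"
  using graph by (auto simp: F_def threshold_edges_def simple_graph_def)

lemma finite_Union_F: "finite (\<Union>F)"
  using Union_F_subset finite_vertices finite_subset by auto

lemma weight_ge: "\<forall>e\<in>F. t \<le> w e"
  by (auto simp: F_def threshold_edges_def)

lemma F_cases: "e \<in> F \<longleftrightarrow> e \<in> H \<or> e \<in> F \<and> w e < 2 * t"
  using t by (auto simp: F_def H_def threshold_edges_def)

lemma dist_less_iff: "x \<noteq> y \<Longrightarrow> d x y < ereal (2 * t) \<longleftrightarrow> {x, y} \<in> F \<and> w {x, y} < 2 * t"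
  unfolding d_def using t weight_ge by (intro weighted_dist_less_iff) auto

lemma close_nbhd_eq:
  assumes "U \<subseteq> V" "\<And>x y. x \<in> U \<Longrightarrow> y \<in> V \<Longrightarrow> tab (x, y) = d x y"
  shows "close_nbhd V t H tab U = U \<union> {y. \<exists>x\<in>U. {x, y} \<in> F}"
proof -
  have "{x, y} \<in> H \<or> x \<noteq> y \<and> tab (x, y) < ereal (2 * t) \<longleftrightarrow> {x, y} \<in> F"
    if "x \<in> U" "y \<in> V" for x y
    using that assms(2)[OF that] dist_less_iff[of x y] F_edges[of x y] F_cases[of "{x, y}"] by auto
  then show ?thesis unfolding close_nbhd_def using F_edges by blast
qed

lemma card_nbhd:
  assumes "U \<subseteq> V" "\<forall>v\<in>V. vdegree E v \<le> D"
  shows "card (U \<union> {y. \<exists>x\<in>U. {x, y} \<in> F}) \<le> (D + 1) * card U"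
proof -
  have U: "finite U" using assms finite_vertices finite_subset by auto
  have E: "finite E"
    using graph finite_subset[of E "Pow V"] by (auto simp: simple_graph_def)
  have "card {y. {x, y} \<in> F} \<le> D" if "x \<in> U" for x
  proof -
    have "card {y. {x, y} \<in> F} = card ((\<lambda>y. {x, y}) ` {y. {x, y} \<in> F})"
      by (intro card_image[symmetric] inj_onI) (auto simp: doubleton_eq_iff)
    also have "\<dots> \<le> vdegree E x"
      unfolding vdegree_def using E by (intro card_mono) (auto simp: F_def threshold_edges_def)
    finally show ?thesis using assms that by (meson le_trans subsetD)
  qed
  then have "(\<Sum>x\<in>U. card {y. {x, y} \<in> F}) \<le> (\<Sum>x\<in>U. D)" by (intro sum_mono)
  moreover have "card {y. \<exists>x\<in>U. {x, y} \<in> F} \<le> (\<Sum>x\<in>U. card {y. {x, y} \<in> F})"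
  proof -
    have "{y. \<exists>x\<in>U. {x, y} \<in> F} = (\<Union>x\<in>U. {y. {x, y} \<in> F})" by auto
    then show ?thesis using card_UN_le[OF U, of "\<lambda>x. {y. {x, y} \<in> F}"] by simp
  qed
  ultimately show ?thesis using card_Un_le[of U "{y. \<exists>x\<in>U. {x, y} \<in> F}"] by (simp add: mult.commute)
qed

text \<open>If no center reaches \<open>x\<close>, none reaches any \<open>y\<close> in its
  component, so the finite \<open>d x y\<close> lies below every \<open>d a y\<close>.\<close>

lemma component_subset_cluster:
  assumes "x \<in> V" "\<forall>a\<in>A. d a x = \<infinity>"
  shows "{y \<in> V - {x}. same_component F x y} \<subseteq> cluster V d A x"
proof
  fix y assume y: "y \<in> {y \<in> V - {x}. same_component F x y}"
  then have "d x y \<noteq> \<infinity>" by (simp add: d_def weighted_dist_eq_infinity_iff)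
  moreover have "d a y = \<infinity>" if "a \<in> A" for a
    using that assms(2) y same_component_trans[of F a y x] same_component_sym[of F x y]
    unfolding d_def weighted_dist_eq_infinity_iff by blast
  ultimately show "y \<in> cluster V d A x" using y by (auto simp: cluster_def)
qed

text \<open>The three parts of \<open>P\<close> match the cases: an endpoint within one step of its
  nearest center, both endpoints in the cluster of a vertex \<open>b\<close> two steps from a
  center, or a component without a center.\<close>

lemma light_edge_covered:
  assumes "{u, v} \<in> F" "w {u, v} < 2 * t" "A \<subseteq> V"
    and N1: "N1 = A \<union> {y. \<exists>x\<in>A. {x, y} \<in> F}" and N2: "N2 = N1 \<union> {y. \<exists>x\<in>N1. {x, y} \<in> F}"
    and P: "P = N2 \<times> V \<union> (\<Union>b\<in>N2. cluster V d A b \<times> cluster V d A b) \<union>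
      {(x, y). x \<in> V \<and> (\<forall>a\<in>A. d a x = \<infinity>) \<and> y \<in> V - {x} \<and> same_component F x y}"
  shows "(u, v) \<in> P \<or> (v, u) \<in> P"
proof (cases "\<forall>a\<in>A. d a u = \<infinity>")
  case True
  then have "(u, v) \<in> P"
    using F_edges[OF assms(1)] same_component_edge[OF assms(1)] unfolding P by auto
  then show ?thesis ..
next
  case False
  \<comment> \<open>Stated for arbitrary \<open>u\<close> and \<open>v\<close>, since the edge is
    used in the orientation in which its first endpoint is the one closer to the centers.\<close>
  have covered: "(u, v) \<in> P" if uv: "{u, v} \<in> F" "w {u, v} < 2 * t" and a: "a \<in> A" "d a u \<noteq> \<infinity>"
    "\<forall>a'\<in>A. d a u \<le> d a' u" "\<forall>a'\<in>A. d a u \<le> d a' v" for a u v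
  proof -
    have "same_component F a u" using a(2) by (simp add: d_def weighted_dist_eq_infinity_iff)
    then consider "u = a" | "{a, u} \<in> F" | x b where "{a, x} \<in> F" "{x, b} \<in> F"
        "u \<in> cluster V d A b" "v \<in> cluster V d A b"
      unfolding d_def using a uv t weight_ge Union_F_subset finite_Union_F
      using light_edge_in_cluster[of F V t w u v a A] by (auto simp: d_def)
    then show ?thesis
    proof cases
      case 1
      then have "u \<in> N2" using a(1) by (simp add: N1 N2)
      then show ?thesis using F_edges[OF uv(1)] by (simp add: P)
    next
      case 2
      then have "u \<in> N2" using a(1) by (auto simp: N1 N2)
      then show ?thesis using F_edges[OF uv(1)] by (simp add: P)
    next
      case 3
      then have "b \<in> N2" using a(1) by (auto simp: N1 N2)
      then show ?thesis using 3 by (auto simp: P)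
    qed
  qed
  have fin: "finite A" using assms(3) finite_vertices finite_subset by auto
  have "A \<noteq> {}" using False by auto
  with fin obtain a where a: "a \<in> A" "\<forall>a'\<in>A. d a u \<le> d a' u"
    using Min_in[of "(\<lambda>a. d a u) ` A"] Min_le[of "(\<lambda>a. d a u) ` A"] by fastforce
  from fin \<open>A \<noteq> {}\<close> obtain b where b: "b \<in> A" "\<forall>a'\<in>A. d b v \<le> d a' v"
    using Min_in[of "(\<lambda>a. d a v) ` A"] Min_le[of "(\<lambda>a. d a v) ` A"] by fastforce
  have au: "d a u \<noteq> \<infinity>" using False a by auto
  show ?thesis
  proof (cases "d a u \<le> d b v")
    case True
    then show ?thesis using covered[of u v a] assms(1,2) a b au by (meson order_trans)
  next
    case False
    \<comment> \<open>Now \<open>d b v < d a u\<close>, and \<open>d a u\<close> is minimal over the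
      centers, so the endpoints exchange roles.\<close>
    then have "d b v \<noteq> \<infinity>" "\<forall>a'\<in>A. d b v \<le> d a' u" using a by (auto intro: order_trans less_imp_le)
    then show ?thesis using covered[of v u b] assms(1,2) b by (simp add: insert_commute)
  qed
qed

text \<open>\<open>K\<close> is quantified after \<open>c\<close> and \<open>N\<close>, so the same
  run can be estimated with a good cluster bound and with the trivial one \<open>card V\<close>. For
  the same reason \<open>N\<close>, which is \<open>card N2\<close>, has both a degree bound and a
  trivial bound.\<close>

lemma computes_add_light_edges:
  assumes A: "A \<subseteq> V" and k: "card V \<le> 2 ^ k" and D: "\<forall>v\<in>V. vdegree E v \<le> D"
  shows "\<exists>c N. computes (answer E w) (add_light_edges V t k H A) F c \<and>
    N \<le> card V \<and> N \<le> (D + 1) ^ 2 * card A \<and>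
    (\<forall>K. (\<forall>b\<in>V. card (cluster V d A b) \<le> K) \<longrightarrow>
       c \<le> N * (4 * card V + K ^ 2) + card V * (1 + (2 * k + 1) * K))"
proof -
  let ?n = "card V"
  define N1 where "N1 = A \<union> {y. \<exists>x\<in>A. {x, y} \<in> F}"
  define N2 where "N2 = N1 \<union> {y. \<exists>x\<in>N1. {x, y} \<in> F}"
  define Z where "Z = {x \<in> V. \<forall>a\<in>A. d a x = \<infinity>}"
  define C where "C = cluster V d A"
  define comp where "comp x = {y \<in> V - {x}. same_component F x y}" for x
  define P where "P = N2 \<times> V \<union> (\<Union>b\<in>N2. C b \<times> C b) \<union> Sigma Z comp"
  define tab where "tab U = (\<lambda>k. if k \<in> U then d (fst k) (snd k) else undefined)" for U
  have N1: "A \<subseteq> N1" "N1 \<subseteq> V" using A F_edges by (auto simp: N1_def)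
  have N2: "N1 \<subseteq> N2" "N2 \<subseteq> V" using N1 F_edges by (auto simp: N2_def)
  have fin: "finite V" "finite N2" "finite Z"
    using finite_vertices N2 finite_subset by (auto simp: Z_def)
  have CV: "C b \<subseteq> V" for b by (simp add: C_def cluster_subset)
  have table: "computes (answer E w) (dist_table V t U) (tab U) (card U)" if "U \<subseteq> V \<times> V" for U
  proof -
    have "tab U = (\<lambda>k. if k \<in> U then answer E w (Dist_Query (fst k) (snd k) t) else undefined)"
      by (auto simp: tab_def d_def F_def)
    then show ?thesis using computes_dist_table[OF fin(1) that] by simp
  qed
  have "\<forall>x\<in>Z. \<exists>c. c \<le> 1 + 2 * k * card (comp x) \<and>
      computes (answer E w) (component_list k x t (list_of_set (V - {x}))) (comp x) c"
  proof
    fix x assume "x \<in> Z"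
    have l: "set (list_of_set (V - {x})) = V - {x}" "distinct (list_of_set (V - {x}))"
      using list_of_set[of "V - {x}"] fin(1) by simp_all
    then have "length (list_of_set (V - {x})) = card (V - {x})" by (metis distinct_card)
    also have "\<dots> \<le> 2 ^ k" using k fin(1) by (meson card_Diff1_le le_trans)
    finally show "\<exists>c. c \<le> 1 + 2 * k * card (comp x) \<and>
        computes (answer E w) (component_list k x t (list_of_set (V - {x}))) (comp x) c"
      using computes_component_list[of "list_of_set (V - {x})" k E w t x] l
      by (auto simp: comp_def F_def)
  qed
  then obtain c where c: "\<And>x. x \<in> Z \<Longrightarrow> c x \<le> 1 + 2 * k * card (comp x)"
    "\<And>x. x \<in> Z \<Longrightarrow> computes (answer E w) (component_list k x t (list_of_set (V - {x}))) (comp x) (c x)"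
    by metis
  define g where "g = (\<lambda>x. if x \<in> Z then comp x else undefined)"
  have gather: "computes (answer E w) (gather (\<lambda>x. component_list k x t (list_of_set (V - {x}))) Z) g
      (\<Sum>x\<in>Z. c x)"
    unfolding g_def by (intro computes_gather fin c(2))
  have close1: "close_nbhd V t H (tab (A \<times> V)) A = N1"
    using A by (subst close_nbhd_eq) (auto simp: tab_def N1_def)
  have close2: "close_nbhd V t H (tab (N1 \<times> V)) N1 = N2"
    using N1 by (subst close_nbhd_eq) (auto simp: tab_def N2_def)
  have Z_eq: "{x \<in> V. \<forall>a\<in>A. tab (A \<times> V) (a, x) = \<infinity>} = Z"
    by (auto simp: Z_def tab_def)
  \<comment> \<open>Since \<open>A\<close> is contained in \<open>N2\<close>, one table holds both
    sides of the comparison that defines the cluster.\<close>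
  have C_eq: "cluster V (curry (tab (N2 \<times> V))) A b = C b" if "b \<in> N2" for b
    using that N1(1) N2(1) unfolding C_def cluster_def tab_def by auto
  have P_eq: "N2 \<times> V \<union> (\<Union>b\<in>N2. cluster V (curry (tab (N2 \<times> V))) A b \<times>
      cluster V (curry (tab (N2 \<times> V))) A b) \<union> Sigma Z g = P"
    using C_eq by (auto simp: P_def g_def)
  have PV: "P \<subseteq> V \<times> V" using CV N2 by (auto simp: P_def comp_def Z_def)
  have result: "H \<union> {{x, y} |x y. (x, y) \<in> P \<and> x \<noteq> y \<and> tab P (x, y) < ereal (2 * t)} = F"
    (is "H \<union> ?L = F")
  proof
    have "?L \<subseteq> F" using dist_less_iff by (auto simp: tab_def)
    moreover have "H \<subseteq> F" using F_cases by auto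
    ultimately show "H \<union> ?L \<subseteq> F" by simp
    show "F \<subseteq> H \<union> ?L"
    proof
      fix e assume e: "e \<in> F"
      then obtain u v where uv: "e = {u, v}" "u \<noteq> v"
        using graph by (auto simp: F_def threshold_edges_def simple_graph_def)
      show "e \<in> H \<union> ?L"
      proof (cases "e \<in> H")
        case False
        then have light: "{u, v} \<in> F" "w {u, v} < 2 * t" using e F_cases[of e] uv by auto
        have "(u, v) \<in> P \<or> (v, u) \<in> P"
          by (rule light_edge_covered[OF light A N1_def N2_def])
            (auto simp: P_def C_def comp_def Z_def)
        moreover have "d u v < ereal (2 * t)" "d v u < ereal (2 * t)"
          using dist_less_iff uv(2) light by (auto simp: insert_commute)
        moreover have "tab P (x, y) = d x y" if "(x, y) \<in> P" for x y
          using that by (simp add: tab_def)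
        ultimately show ?thesis
          using uv insert_commute[of u v "{}"] by (smt (verit) UnI2 mem_Collect_eq)
      qed simp
    qed
  qed
  have comp: "computes (answer E w) (add_light_edges V t k H A) F
      (card (A \<times> V) + (card (N1 \<times> V) + (card (N2 \<times> V) + (sum c Z + (card P + 0)))))"
    unfolding add_light_edges_def Let_def
    apply (rule computes_bind_alg[OF table])
     using A apply blast
    unfolding close1 Z_eq
    apply (rule computes_bind_alg[OF table])
     using N1 apply blast
    unfolding close2
    apply (rule computes_bind_alg[OF table])
     using N2 apply blast
    apply (rule computes_bind_alg[OF gather])
    unfolding P_eq
    apply (rule computes_bind_alg[OF table[OF PV]])
    unfolding result
    by (rule computes_Return)
  have "card N2 \<le> (D + 1) * card N1" "card N1 \<le> (D + 1) * card A"
    unfolding N2_def using card_nbhd[OF N1(2) D] card_nbhd[OF A D] by (auto simp: N1_def)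
  then have N2_card: "card N2 \<le> (D + 1) ^ 2 * card A"
    by (metis le_trans mult.assoc mult_le_mono2 power2_eq_square)
  moreover have "card N2 \<le> card V" using N2 fin by (intro card_mono)
  moreover have "card (A \<times> V) + (card (N1 \<times> V) + (card (N2 \<times> V) + (sum c Z + (card P + 0))))
      \<le> card N2 * (4 * ?n + K ^ 2) + ?n * (1 + (2 * k + 1) * K)"
    if K: "\<forall>b\<in>V. card (cluster V d A b) \<le> K" for K
  proof -
    have card: "card A \<le> card N2" "card N1 \<le> card N2"
      using N1 N2 fin by (auto intro!: card_mono)
    have compK: "card (comp x) \<le> K" if "x \<in> Z" for x
    proof -
      have "card (comp x) \<le> card (C x)"
        using component_subset_cluster[of x A] that finite_subset[OF CV fin(1)]
        by (intro card_mono) (auto simp: comp_def C_def Z_def)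
      then show ?thesis using K that by (auto simp: C_def Z_def intro: le_trans)
    qed
    have cZ: "card Z \<le> ?n" using fin by (intro card_mono) (auto simp: Z_def)
    have "c x \<le> 1 + 2 * k * K" if "x \<in> Z" for x
      using c(1)[OF that] compK[OF that] by (meson add_left_mono le_trans mult_le_mono2)
    then have "sum c Z \<le> (\<Sum>x\<in>Z. 1 + 2 * k * K)" by (intro sum_mono)
    also have "\<dots> \<le> ?n * (1 + 2 * k * K)" using cZ by (simp add: mult_le_mono1 del: mult_Suc_right)
    finally have sc: "sum c Z \<le> ?n * (1 + 2 * k * K)" .
    have "card (\<Union>b\<in>N2. C b \<times> C b) \<le> (\<Sum>b\<in>N2. card (C b \<times> C b))" by (rule card_UN_le[OF fin(2)])
    also have "\<dots> \<le> (\<Sum>b\<in>N2. K ^ 2)"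
      using K N2(2) by (intro sum_mono) (auto simp: card_cartesian_product C_def power2_eq_square intro!: mult_le_mono)
    finally have p2: "card (\<Union>b\<in>N2. C b \<times> C b) \<le> card N2 * K ^ 2" by simp
    have "card (Sigma Z comp) = (\<Sum>x\<in>Z. card (comp x))"
      using fin by (intro card_SigmaI) (auto simp: comp_def)
    also have "\<dots> \<le> (\<Sum>x\<in>Z. K)" using compK by (intro sum_mono)
    also have "\<dots> \<le> ?n * K" using cZ by simp
    finally have p3: "card (Sigma Z comp) \<le> ?n * K" .
    have "card P \<le> card (N2 \<times> V) + card (\<Union>b\<in>N2. C b \<times> C b) + card (Sigma Z comp)"
      unfolding P_def by (meson add_le_mono card_Un_le le_trans order_refl)
    also have "\<dots> \<le> card N2 * ?n + card N2 * K ^ 2 + ?n * K"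
      using p2 p3 by (simp add: card_cartesian_product)
    \<comment> \<open>Four blocks cost at most \<open>card N2 * card V\<close> each: the three
      tables over \<open>A\<close>, \<open>N1\<close> and \<open>N2\<close>, and the pairs
      \<open>N2 \<times> V\<close> in \<open>P\<close>.\<close>
    finally have "card (A \<times> V) + (card (N1 \<times> V) + (card (N2 \<times> V) + (sum c Z + (card P + 0))))
      \<le> card N2 * ?n + (card N2 * ?n + (card N2 * ?n + (?n * (1 + 2 * k * K) +
        (card N2 * ?n + card N2 * K ^ 2 + ?n * K + 0))))"
      unfolding card_cartesian_product using sc card by (intro add_mono mult_le_mono1) auto
    also have "\<dots> = card N2 * (4 * ?n + K ^ 2) + ?n * (1 + (2 * k + 1) * K)"
      by (simp add: algebra_simps)
    finally show ?thesis .
  qed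
  ultimately show ?thesis using comp by blast
qed

end

section \<open>Cost of a layer\<close>

text \<open>Here \<open>l\<close> is meant to satisfy \<open>card V \<le> 4 ^ l\<close>: then
  \<open>2 ^ l\<close> is at least \<open>sqrt n\<close>, and \<open>2 * l\<close> bisection levels
  suffice.\<close>

definition reveal_layer ::
    "'v set \<Rightarrow> nat \<Rightarrow> real \<Rightarrow> 'v set set \<Rightarrow> ('v, 'v set set) query_alg" where
  "reveal_layer V l t H =
     bind_alg (choose_centers V t (1 / 2 ^ l) l {} V) (add_light_edges V t (2 * l) H)"

lemma legal_reveal_layer: "finite V \<Longrightarrow> 1 \<le> t \<Longrightarrow> legal_alg V (reveal_layer V l t H)"
  unfolding reveal_layer_def
  by (intro legal_bind_alg legal_choose_centers legal_add_light_edges)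

lemma one_minus_inverse_power_le:
  fixes m :: real
  assumes "1 \<le> m" "m = real k"
  shows "(1 - 1 / m) ^ k \<le> 1 / 2"
proof -
  have "(1 - 1 / m) ^ k \<le> exp (- (1 / m)) ^ k"
    using assms exp_ge_add_one_self[of "- (1 / m)"] by (intro power_mono) auto
  also have "\<dots> = exp (- 1)" using assms by (simp flip: exp_of_nat_mult)
  also have "\<dots> \<le> 1 / 2" using exp_ge_add_one_self[of 1] by (simp add: exp_minus field_simps)
  finally show ?thesis .
qed

text \<open>The bound \<open>K\<close> on the cluster sizes is chosen such that a cluster exceeding it is overlooked
  with probability at most \<open>(1 - p) ^ K \<le> 2 ^ (- 6 * l) \<le> n ^ (- 3)\<close>, which outweighs the trivial
  cubic bound on the number of queries in that case.\<close>

lemma layer_cost_arith: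
  fixes n D l K :: nat and p :: real
  assumes "n \<le> 4 ^ l" and n: "1 \<le> n"
  defines "K \<equiv> 6 * l * 2 ^ l" and "p \<equiv> 1 / 2 ^ l"
  shows "l * p * real n ^ 2 +
      (real ((D + 1) ^ 2 * (4 * n + K ^ 2)) * (n / 2 ^ l + 2 * real l * p * n) +
       real (n * (1 + (4 * l + 1) * K)) +
       real (n * (4 * n + n ^ 2) + n * (1 + (4 * l + 1) * n)) * (n * (l * (1 - p) ^ K)))
    \<le> 104 * (l + 1) ^ 3 * (D + 1) ^ 2 * 8 ^ l"
proof -
  define M :: real where "M = 2 ^ l"
  \<comment> \<open>\<open>M\<close> bounds \<open>sqrt n\<close> from above; each cost term becomes
    a polynomial in \<open>y\<close> and \<open>Q\<close> times \<open>M ^ 3\<close>.\<close>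
  define x :: real where "x = n"
  define y :: real where "y = l"
  define Q :: real where "Q = (D + 1) ^ 2"
  have M: "1 \<le> M" by (simp add: M_def)
  have M2: "4 ^ l = M ^ 2" "8 ^ l = M ^ 3"
    using power_mult[of "2 :: real" l 2] power_mult[of "2 :: real" 2 l]
      power_mult[of "2 :: real" l 3] power_mult[of "2 :: real" 3 l]
    by (simp_all add: M_def mult.commute)
  have x: "1 \<le> x" "x \<le> M ^ 2"
    using assms(1) n unfolding x_def M2(1)[symmetric] by (simp_all flip: of_nat_le_iff)
  have y: "0 \<le> y" by (simp add: y_def)
  have Q: "1 \<le> Q" by (simp add: Q_def)
  have K: "real K = 6 * y * M" by (simp add: K_def y_def M_def)
  have x2: "x ^ 2 \<le> M ^ 4" using power_mono[OF x(2), of 2] x(1) by (simp flip: power_mult)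
  have x3: "x ^ 3 \<le> M ^ 6" using power_mono[OF x(2), of 3] x(1) by (simp flip: power_mult)
  have xM: "x / M \<le> M" using x M by (simp add: divide_le_eq power2_eq_square)
  have "(1 - 1 / M) ^ (2 ^ l) \<le> 1 / 2"
    using M by (intro one_minus_inverse_power_le) (auto simp: M_def)
  then have "((1 - 1 / M) ^ (2 ^ l)) ^ (6 * l) \<le> (1 / 2) ^ (6 * l)"
    using M by (intro power_mono) auto
  also have "\<dots> = 1 / M ^ 6" by (simp add: M_def power_divide power_mult mult.commute[of 6])
  finally have pK: "(1 - p) ^ K \<le> 1 / M ^ 6"
    by (simp add: p_def M_def K_def power_mult mult.commute[of "6 * l"] del: power_mult_distrib)
  \<comment> \<open>Queries spent on choosing the centers.\<close>
  have bound1: "l * p * real n ^ 2 \<le> y * M ^ 3"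
  proof -
    have "l * p * real n ^ 2 = y * (x ^ 2 / M)" by (simp add: y_def p_def x_def M_def)
    also have "\<dots> \<le> y * M ^ 3" using x2 M y
      by (intro mult_left_mono) (auto simp: divide_le_eq power_eq_if)
    finally show ?thesis .
  qed
  \<comment> \<open>Cost per center times the expected number of centers.\<close>
  have bound2: "real ((D + 1) ^ 2 * (4 * n + K ^ 2)) * (n / 2 ^ l + 2 * real l * p * n)
      \<le> Q * (4 + 36 * y ^ 2) * (1 + 2 * y) * M ^ 3"
  proof -
    have "real ((D + 1) ^ 2 * (4 * n + K ^ 2)) * (n / 2 ^ l + 2 * real l * p * n) =
        Q * (4 * x + 36 * y ^ 2 * M ^ 2) * ((1 + 2 * y) * (x / M))"
      by (simp add: Q_def K x_def y_def p_def M_def power_mult_distrib add_divide_distrib algebra_simps)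
    also have "\<dots> \<le> Q * (4 * M ^ 2 + 36 * y ^ 2 * M ^ 2) * ((1 + 2 * y) * M)"
      using x Q y xM M by (intro mult_mono add_mono mult_left_mono) auto
    also have "\<dots> = Q * (4 + 36 * y ^ 2) * (1 + 2 * y) * M ^ 3"
      by (simp add: algebra_simps power_eq_if)
    finally show ?thesis .
  qed
  \<comment> \<open>Enumeration of the components without a center.\<close>
  have bound3: "real (n * (1 + (4 * l + 1) * K)) \<le> (1 + (4 * y + 1) * (6 * y)) * M ^ 3"
  proof -
    have "real (n * (1 + (4 * l + 1) * K)) = x * (1 + (4 * y + 1) * (6 * y) * M)"
      by (simp add: K x_def y_def algebra_simps)
    also have "\<dots> \<le> M ^ 2 * (M + (4 * y + 1) * (6 * y) * M)"
      using x M y by (intro mult_mono add_mono) auto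
    also have "\<dots> = (1 + (4 * y + 1) * (6 * y)) * M ^ 3"
      by (simp add: algebra_simps power_eq_if)
    finally show ?thesis .
  qed
  \<comment> \<open>Oversized clusters: the cubic trivial cost is \<open>O(M ^ 6)\<close> up to a
    factor in \<open>y\<close>, there are at most \<open>M ^ 2\<close> vertices, and the failure
    probability contributes \<open>1 / M ^ 6\<close>.\<close>
  have bound4: "real (n * (4 * n + n ^ 2) + n * (1 + (4 * l + 1) * n)) * (n * (l * (1 - p) ^ K))
      \<le> y * (4 * y + 7) * M ^ 3"
  proof -
    have "real (n * (4 * n + n ^ 2) + n * (1 + (4 * l + 1) * n)) =
        x ^ 3 + (4 * y + 5) * x ^ 2 + x"
      by (simp add: x_def y_def algebra_simps power_eq_if)
    also have "\<dots> \<le> x ^ 3 + (4 * y + 5) * x ^ 3 + x ^ 3"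
      using x(1) y power_increasing[of 2 3 x] power_increasing[of 1 3 x]
      by (intro add_mono mult_left_mono) auto
    also have "\<dots> = (4 * y + 7) * x ^ 3" by (simp add: algebra_simps)
    also have "\<dots> \<le> (4 * y + 7) * M ^ 6" using x3 y by (intro mult_left_mono) auto
    finally have "real (n * (4 * n + n ^ 2) + n * (1 + (4 * l + 1) * n)) * (n * (l * (1 - p) ^ K))
        \<le> ((4 * y + 7) * M ^ 6) * (M ^ 2 * (y * (1 / M ^ 6)))"
      using pK x y M by (intro mult_mono) (auto simp: x_def y_def p_def M_def)
    also have "\<dots> = y * (4 * y + 7) * M ^ 2" using M by simp
    also have "\<dots> \<le> y * (4 * y + 7) * M ^ 3" using M y power_increasing[of 2 3 M]
      by (intro mult_left_mono) auto
    finally show ?thesis .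
  qed
  have "y * M ^ 3 + (Q * (4 + 36 * y ^ 2) * (1 + 2 * y) * M ^ 3 +
      (1 + (4 * y + 1) * (6 * y)) * M ^ 3 + y * (4 * y + 7) * M ^ 3)
    = (y + (1 + (4 * y + 1) * (6 * y)) + y * (4 * y + 7)) * M ^ 3 +
      (4 + 36 * y ^ 2) * (1 + 2 * y) * (Q * M ^ 3)"
    by (simp add: algebra_simps)
  also have "\<dots> \<le> (y + (1 + (4 * y + 1) * (6 * y)) + y * (4 * y + 7)) * (Q * M ^ 3) +
      (4 + 36 * y ^ 2) * (1 + 2 * y) * (Q * M ^ 3)"
    using y M Q by (intro add_right_mono mult_left_mono) auto
  also have "\<dots> = (y + (1 + (4 * y + 1) * (6 * y)) + y * (4 * y + 7) +
      (4 + 36 * y ^ 2) * (1 + 2 * y)) * (Q * M ^ 3)"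
    by (simp add: algebra_simps)
  also have "\<dots> \<le> (104 * (y + 1) ^ 3) * (Q * M ^ 3)"
  proof (intro mult_right_mono)
    have "0 \<le> y ^ 2" "0 \<le> y ^ 3" using y by auto
    \<comment> \<open>The left side expands to \<open>72 * y ^ 3 + 64 * y ^ 2 + 22 * y + 5\<close>,
      which is compared coefficient by coefficient.\<close>
    then show "y + (1 + (4 * y + 1) * (6 * y)) + y * (4 * y + 7) + (4 + 36 * y ^ 2) * (1 + 2 * y)
      \<le> 104 * (y + 1) ^ 3"
      using y by (simp add: algebra_simps power2_eq_square power3_eq_cube)
  qed (use Q M in auto)
  also have "\<dots> = real (104 * (l + 1) ^ 3 * (D + 1) ^ 2 * 8 ^ l)"
    by (simp add: M2(2) y_def Q_def add.commute)
  finally show ?thesis using bound1 bound2 bound3 bound4 by linarith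
qed

text \<open>An unlucky choice of centers is paid for by the trivial bound times the number of
  vertices with an oversized cluster, whose expectation is small by
  \<open>large_cluster_choose_centers\<close>.\<close>

lemma expected_queries_reveal_layer:
  fixes V :: "'v set"
  assumes graph: "simple_graph V E" and t: "1 \<le> t" and l: "card V \<le> 4 ^ l" and "V \<noteq> {}"
    and D: "\<forall>v\<in>V. vdegree E v \<le> D"
  shows "expected_queries (answer E w) (reveal_layer V l t (threshold_edges E w (2 * t)))
    \<le> ennreal (104 * (l + 1) ^ 3 * (D + 1) ^ 2 * 8 ^ l)"
proof -
  let ?ans = "answer E w" and ?n = "card V" and ?p = "1 / 2 ^ l :: real"
  let ?d = "weighted_dist (threshold_edges E w t) w"
  let ?B = "choose_centers V t ?p l {} V"
  define K where "K = 6 * l * 2 ^ l"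
  define a where "a = (D + 1) ^ 2 * (4 * ?n + K ^ 2)"
  define g where "g = ?n * (1 + (4 * l + 1) * K)"
  \<comment> \<open>The deterministic cost bound with both \<open>N\<close> and \<open>K\<close>
    replaced by \<open>card V\<close>.\<close>
  define h where "h = ?n * (4 * ?n + ?n ^ 2) + ?n * (1 + (4 * l + 1) * ?n)"
  have V: "finite V" using graph by (simp add: simple_graph_def)
  have p: "0 \<le> ?p" "?p \<le> 1" by simp_all
  have k: "card V \<le> 2 ^ (2 * l)" using l by (simp add: power_mult)
  have d: "?d = (\<lambda>x y. ?ans (Dist_Query x y t))" by auto
  have cost: "expected_queries ?ans (add_light_edges V t (2 * l) (threshold_edges E w (2 * t)) A)
    \<le> of_nat a * of_nat (card A) + of_nat g + of_nat h * (\<Sum>b\<in>V. of_bool (K < card (cluster V ?d A b)))"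
    if "A \<in> fst ` set_pmf (run_alg ?ans ?B)" for A
  proof -
    have "A \<subseteq> V" using results_choose_centers[of "{}" V V] that by blast
    from computes_add_light_edges[OF graph t refl refl refl this k D] obtain c N where
      comp: "computes ?ans (add_light_edges V t (2 * l) (threshold_edges E w (2 * t)) A)
        (threshold_edges E w t) c"
      and N: "N \<le> ?n" "N \<le> (D + 1) ^ 2 * card A"
      and c: "\<And>K. \<forall>b\<in>V. card (cluster V ?d A b) \<le> K \<Longrightarrow>
        c \<le> N * (4 * ?n + K ^ 2) + ?n * (1 + (2 * (2 * l) + 1) * K)" by blast
    have "c \<le> a * card A + g + h * (\<Sum>b\<in>V. of_bool (K < card (cluster V ?d A b)))"
    proof (cases "\<forall>b\<in>V. card (cluster V ?d A b) \<le> K")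
      case True
      have "N * (4 * ?n + K ^ 2) \<le> a * card A"
        using mult_le_mono1[OF N(2), of "4 * ?n + K ^ 2"] by (simp only: a_def ac_simps)
      moreover have "c \<le> N * (4 * ?n + K ^ 2) + g" using c[OF True] by (simp add: g_def)
      ultimately show ?thesis by linarith
    next
      case False
      then obtain b where b: "b \<in> V" "K < card (cluster V ?d A b)" by auto
      have "(1::nat) \<le> (\<Sum>b\<in>V. of_bool (K < card (cluster V ?d A b)))"
        using member_le_sum[of b V "\<lambda>b. of_bool (K < card (cluster V ?d A b)) :: nat"] b V by simp
      then have "h \<le> h * (\<Sum>b\<in>V. of_bool (K < card (cluster V ?d A b)))" by simp
      moreover have "c \<le> N * (4 * ?n + ?n ^ 2) + ?n * (1 + (4 * l + 1) * ?n)"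
        using c[of ?n] card_mono[OF V cluster_subset] by simp
      moreover have "N * (4 * ?n + ?n ^ 2) \<le> ?n * (4 * ?n + ?n ^ 2)"
        using N(1) by (rule mult_le_mono1)
      ultimately show ?thesis unfolding h_def by linarith
    qed
    from of_nat_mono[OF this, where 'a = ennreal] show ?thesis
      unfolding computes_expected_queries[OF comp] by (simp add: of_nat_sum)
  qed
  \<comment> \<open>The start values are \<open>A = {}\<close> and \<open>W = V\<close>, so the
    \<open>card {}\<close> term and the indicators of \<open>b \<notin> V\<close> vanish in the next
    step.\<close>
  have "expected_queries ?ans (reveal_layer V l t (threshold_edges E w (2 * t)))
    \<le> ennreal (l * ?p * real ?n ^ 2) + (of_nat a * ennreal (real (card ({} :: 'v set)) + real ?n / 2 ^ l + 2 * real l * ?p * ?n) + of_nat g +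
      of_nat h * (\<Sum>b\<in>V. of_bool (b \<notin> V \<and> K < card (cluster V ?d {} b)) + ennreal (l * (1 - ?p) ^ K)))"
    unfolding reveal_layer_def expected_queries_bind_alg
  proof (intro add_mono)
    show "expected_queries ?ans ?B \<le> ennreal (l * ?p * real ?n ^ 2)"
      by (rule expected_queries_choose_centers[OF V p]) auto
    have "expect_result ?ans ?B (\<lambda>A. expected_queries ?ans
          (add_light_edges V t (2 * l) (threshold_edges E w (2 * t)) A))
      \<le> expect_result ?ans ?B (\<lambda>A. of_nat a * of_nat (card A) + of_nat g +
          of_nat h * (\<Sum>b\<in>V. of_bool (K < card (cluster V ?d A b))))"
      by (intro expect_result_mono cost)
    also have "\<dots> \<le> of_nat a * ennreal (real (card ({} :: 'v set)) + real ?n / 2 ^ l + 2 * real l * ?p * ?n) + of_nat g +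
      of_nat h * (\<Sum>b\<in>V. of_bool (b \<notin> V \<and> K < card (cluster V ?d {} b)) + ennreal (l * (1 - ?p) ^ K))"
      unfolding expect_result_add expect_result_cmult expect_result_sum expect_result_const
      by (intro add_mono mult_left_mono sum_mono order_refl
          expected_card_choose_centers[OF V p d]
          large_cluster_choose_centers[OF V p d]) auto
    finally show "expect_result ?ans ?B (\<lambda>A. expected_queries ?ans
          (add_light_edges V t (2 * l) (threshold_edges E w (2 * t)) A)) \<le> \<dots>" .
  qed
  also have "\<dots> = ennreal (l * ?p * real ?n ^ 2 + (real a * (?n / 2 ^ l + 2 * real l * ?p * ?n) +
       real g + real h * (?n * (l * (1 - ?p) ^ K))))"
    by (simp add: ennreal_of_nat_eq_real_of_nat flip: ennreal_mult ennreal_plus)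
  also have "\<dots> \<le> ennreal (104 * (l + 1) ^ 3 * (D + 1) ^ 2 * 8 ^ l)"
    unfolding a_def g_def h_def K_def using layer_cost_arith[OF l, of D] V \<open>V \<noteq> {}\<close>
    by (intro ennreal_leI) (simp add: Suc_le_eq card_gt_0_iff)
  finally show ?thesis .
qed

section \<open>The reconstruction algorithm\<close>

text \<open>Correct for every outcome of the sampling: poor centers cost queries but never lose an
  edge.\<close>

lemma results_reveal_layer:
  assumes graph: "simple_graph V E" and t: "1 \<le> t" and l: "card V \<le> 4 ^ l"
  shows "fst ` set_pmf (run_alg (answer E w) (reveal_layer V l t (threshold_edges E w (2 * t))))
    \<subseteq> {threshold_edges E w t}"
proof -
  have k: "card V \<le> 2 ^ (2 * l)" using l by (simp add: power_mult)
  \<comment> \<open>Only the result matters here, so any degree bound serves as a witness.\<close>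
  have D: "\<forall>v\<in>V. vdegree E v \<le> Max (vdegree E ` V)"
    using graph by (auto simp: simple_graph_def)
  have light: "fst ` set_pmf (run_alg (answer E w)
      (add_light_edges V t (2 * l) (threshold_edges E w (2 * t)) A)) = {threshold_edges E w t}"
    if A: "A \<subseteq> V" for A
  proof -
    obtain c where "computes (answer E w)
        (add_light_edges V t (2 * l) (threshold_edges E w (2 * t)) A) (threshold_edges E w t) c"
      using computes_add_light_edges[OF graph t refl refl refl A k D, of w] by blast
    then show ?thesis by (rule computes_results)
  qed
  show ?thesis
    unfolding reveal_layer_def results_bind_alg
  proof (rule UN_least)
    fix A
    assume "A \<in> fst ` set_pmf (run_alg (answer E w) (choose_centers V t (1 / 2 ^ l) l {} V))"
    then have "A \<subseteq> V" using results_choose_centers[of "{}" V V] by blast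
    from light[OF this] show "fst ` set_pmf (run_alg (answer E w)
        (add_light_edges V t (2 * l) (threshold_edges E w (2 * t)) A)) \<subseteq> {threshold_edges E w t}"
      by simp
  qed
qed

primrec reveal_layers :: "'v set \<Rightarrow> nat \<Rightarrow> nat \<Rightarrow> 'v set set \<Rightarrow> ('v, 'v set set) query_alg" where
  "reveal_layers V l 0 H = Return H"
| "reveal_layers V l (Suc j) H = bind_alg (reveal_layer V l (2 ^ j) H) (reveal_layers V l j)"

lemma legal_reveal_layers: "finite V \<Longrightarrow> legal_alg V (reveal_layers V l j H)"
  by (induction j arbitrary: H) (auto intro!: legal_bind_alg legal_reveal_layer)

lemma reveal_layers:
  assumes graph: "simple_graph V E" and l: "card V \<le> 4 ^ l"
  shows "fst ` set_pmf (run_alg (answer E w) (reveal_layers V l j (threshold_edges E w (2 ^ j))))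
      \<subseteq> {threshold_edges E w 1}"
    and "V \<noteq> {} \<Longrightarrow> \<forall>v\<in>V. vdegree E v \<le> D \<Longrightarrow>
      expected_queries (answer E w) (reveal_layers V l j (threshold_edges E w (2 ^ j)))
        \<le> of_nat j * ennreal (104 * (l + 1) ^ 3 * (D + 1) ^ 2 * 8 ^ l)"
proof (induction j)
  case 0
  show "fst ` set_pmf (run_alg (answer E w) (reveal_layers V l 0 (threshold_edges E w (2 ^ 0))))
      \<subseteq> {threshold_edges E w 1}" by simp
  show "expected_queries (answer E w) (reveal_layers V l 0 (threshold_edges E w (2 ^ 0)))
        \<le> of_nat 0 * ennreal (104 * (l + 1) ^ 3 * (D + 1) ^ 2 * 8 ^ l)" by simp
next
  case (Suc j)
  have t: "1 \<le> (2 ^ j :: real)" by simp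
  have res: "fst ` set_pmf (run_alg (answer E w) (reveal_layer V l (2 ^ j) (threshold_edges E w (2 ^ Suc j))))
      \<subseteq> {threshold_edges E w (2 ^ j)}"
    using results_reveal_layer[OF graph t l] by simp
  show "fst ` set_pmf (run_alg (answer E w) (reveal_layers V l (Suc j) (threshold_edges E w (2 ^ Suc j))))
      \<subseteq> {threshold_edges E w 1}"
    unfolding reveal_layers.simps using Suc.IH(1) by (rule results_bind_alg_subset[OF res])
  let ?c = "ennreal (104 * (l + 1) ^ 3 * (D + 1) ^ 2 * 8 ^ l)"
  assume V: "V \<noteq> {}" and D: "\<forall>v\<in>V. vdegree E v \<le> D"
  have "expected_queries (answer E w) (reveal_layers V l (Suc j) (threshold_edges E w (2 ^ Suc j)))
    \<le> ?c + of_nat j * ?c"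
    unfolding reveal_layers.simps expected_queries_bind_alg expect_result_unique[OF res]
    using expected_queries_reveal_layer[OF graph t l V D, of w] Suc.IH(2)[OF V D]
    by (intro add_mono) simp_all
  also have "\<dots> = of_nat (Suc j) * ?c" by (simp add: algebra_simps)
  finally show "expected_queries (answer E w) (reveal_layers V l (Suc j) (threshold_edges E w (2 ^ Suc j)))
    \<le> of_nat (Suc j) * ?c" .
qed

section \<open>Reading off the weights\<close>

text \<open>Edges are sets while a weight query takes an ordered pair; the answer depends only on
  the set, so any orientation will do.\<close>

definition endpoints :: "'v set \<Rightarrow> 'v \<times> 'v" where
  "endpoints e = (SOME p. e = {fst p, snd p})"

lemma endpoints: "e = {u, v} \<Longrightarrow> {fst (endpoints e), snd (endpoints e)} = e"
  unfolding endpoints_def by (rule someI2[of _ "(u, v)"]) auto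

text \<open>Threshold 1 admits every edge when all weights are at least 1. The intersection keeps
  the queries legal for an arbitrary computed edge set.\<close>

definition weight_table :: "'v set \<Rightarrow> 'v set set \<Rightarrow> ('v, 'v set \<Rightarrow> ereal) query_alg" where
  "weight_table V E = gather
     (\<lambda>e. Ask (Weight_Query (fst (endpoints e)) (snd (endpoints e)) 1) Return)
     (E \<inter> {{u, v} |u v. u \<in> V \<and> v \<in> V \<and> u \<noteq> v})"

lemma finite_pairs: "finite V \<Longrightarrow> finite {{u, v} |u v. u \<in> V \<and> v \<in> V \<and> u \<noteq> v}"
  by (rule finite_subset[of _ "Pow V"]) auto

lemma legal_weight_table:
  assumes "finite V"
  shows "legal_alg V (weight_table V E)"
  unfolding weight_table_def
proof (intro legal_gather)
  fix e assume "e \<in> E \<inter> {{u, v} |u v. u \<in> V \<and> v \<in> V \<and> u \<noteq> v}"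
  then obtain u v where "e = {u, v}" "u \<in> V" "v \<in> V" by auto
  moreover from this(1) have "{fst (endpoints e), snd (endpoints e)} = {u, v}"
    using endpoints by metis
  ultimately show "legal_alg V (Ask (Weight_Query (fst (endpoints e)) (snd (endpoints e)) 1) Return)"
    by (auto simp: doubleton_eq_iff)
qed (use finite_pairs[OF assms] in auto)

lemma computes_weight_table:
  assumes "simple_graph V E" "\<forall>e\<in>E. 1 \<le> w e"
  shows "computes (answer E w) (weight_table V E) (\<lambda>e. if e \<in> E then ereal (w e) else undefined) (card E)"
proof -
  have E: "E \<inter> {{u, v} |u v. u \<in> V \<and> v \<in> V \<and> u \<noteq> v} = E" "finite E"
    using assms(1) finite_pairs[of V] by (auto simp: simple_graph_def intro: finite_subset)
  have "computes (answer E w) (gather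
     (\<lambda>e. Ask (Weight_Query (fst (endpoints e)) (snd (endpoints e)) 1) Return) E)
     (\<lambda>e. if e \<in> E then ereal (w e) else undefined) (\<Sum>e\<in>E. 1)"
  proof (intro computes_gather E)
    fix e assume e: "e \<in> E"
    then obtain u v where "e = {u, v}" using assms(1) by (auto simp: simple_graph_def)
    from endpoints[OF this] e assms(2)
    show "computes (answer E w) (Ask (Weight_Query (fst (endpoints e)) (snd (endpoints e)) 1) Return)
        (ereal (w e)) 1"
      by (simp add: computes_def threshold_edges_def)
  qed
  then show ?thesis by (simp add: weight_table_def E)
qed

section \<open>Choice of the parameters and the complete algorithm\<close>

text \<open>The least exponent makes \<open>2 ^ depth n\<close> agree with \<open>sqrt n\<close> up
  to a factor 2 for \<open>n \<ge> 2\<close>.\<close>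

definition depth :: "nat \<Rightarrow> nat" where
  "depth n = (LEAST l. n \<le> 4 ^ l)"

lemma le_power_depth: "n \<le> 4 ^ depth n"
  unfolding depth_def by (rule LeastI[of _ n]) (simp add: less_imp_le)

lemma power_depth_less:
  assumes "2 \<le> n"
  shows "4 ^ depth n < 4 * n"
proof (cases "depth n")
  case 0
  then show ?thesis using assms by simp
next
  case (Suc l)
  then have "\<not> n \<le> 4 ^ l" using not_less_Least[of l "\<lambda>l. n \<le> 4 ^ l"] by (simp add: depth_def)
  then show ?thesis using Suc by simp
qed

text \<open>The successor makes \<open>2 ^ layer_count W\<close> exceed \<open>W\<close> strictly,
  even for a power of two, so the recursion may start from the empty edge set.\<close>

definition layer_count :: "real \<Rightarrow> nat" where
  "layer_count W = Suc (nat \<lfloor>log 2 W\<rfloor>)"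

lemma less_power_layer_count:
  assumes "1 \<le> W"
  shows "W < 2 ^ layer_count W"
proof -
  have "log 2 W < real (layer_count W)"
    using assms by (auto simp: layer_count_def) linarith
  then have "2 powr log 2 W < 2 powr real (layer_count W)" by simp
  then show ?thesis using assms by (simp add: powr_realpow)
qed

definition reconstruct :: "'v set \<Rightarrow> real \<Rightarrow> ('v, 'v set set \<times> ('v set \<Rightarrow> real)) query_alg" where
  "reconstruct V W =
     bind_alg (reveal_layers V (depth (card V)) (layer_count W) {}) (\<lambda>E.
     bind_alg (weight_table V E) (\<lambda>g. Return (E, \<lambda>e. real_of_ereal (g e))))"

lemma legal_reconstruct: "finite V \<Longrightarrow> legal_alg V (reconstruct V W)"
  unfolding reconstruct_def
  by (intro legal_bind_alg legal_reveal_layers legal_weight_table) auto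

context
  fixes V :: "'v set" and E :: "'v set set" and w :: "'v set \<Rightarrow> real"
  assumes graph: "simple_graph V E" and ne: "E \<noteq> {}" and w: "\<forall>e\<in>E. 1 \<le> w e"
begin

lemma finite_edges: "finite E"
  using graph finite_pairs[of V] by (auto simp: simple_graph_def intro: finite_subset)

lemma max_weight_ge_one: "1 \<le> max_weight E w"
  using finite_edges ne w unfolding max_weight_def by (auto simp: Max_ge_iff)

lemma initial_threshold_edges: "{} = threshold_edges E w (2 ^ layer_count (max_weight E w))"
proof -
  have "w e < 2 ^ layer_count (max_weight E w)" if "e \<in> E" for e
  proof -
    have "w e \<le> max_weight E w" using that finite_edges by (auto simp: max_weight_def)
    also have "\<dots> < 2 ^ layer_count (max_weight E w)"
      by (rule less_power_layer_count[OF max_weight_ge_one])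
    finally show ?thesis .
  qed
  then show ?thesis by (force simp: threshold_edges_def)
qed

lemma final_threshold_edges: "threshold_edges E w 1 = E"
  using w by (auto simp: threshold_edges_def)

lemma results_reconstruct:
  assumes "r \<in> fst ` set_pmf (run_alg (answer E w) (reconstruct V (max_weight E w)))"
  shows "fst r = E \<and> (\<forall>e\<in>E. snd r e = w e)"
proof -
  have "fst ` set_pmf (run_alg (answer E w)
      (reveal_layers V (depth (card V)) (layer_count (max_weight E w)) {})) \<subseteq> {E}"
    using reveal_layers(1)[OF graph le_power_depth, of w "layer_count (max_weight E w)"]
      initial_threshold_edges final_threshold_edges by simp
  moreover have "fst ` set_pmf (run_alg (answer E w)
      (bind_alg (weight_table V E) (\<lambda>g. Return (E, \<lambda>e. real_of_ereal (g e)))))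
    \<subseteq> {(E, \<lambda>e. real_of_ereal (if e \<in> E then ereal (w e) else undefined))}"
    unfolding results_bind_alg computes_results[OF computes_weight_table[OF graph w]] by simp
  ultimately have "fst ` set_pmf (run_alg (answer E w) (reconstruct V (max_weight E w)))
    \<subseteq> {(E, \<lambda>e. real_of_ereal (if e \<in> E then ereal (w e) else undefined))}"
    unfolding reconstruct_def
    by (rule results_bind_alg_subset[where r = E])
  with assms have "r = (E, \<lambda>e. real_of_ereal (if e \<in> E then ereal (w e) else undefined))"
    by (meson singletonD subsetD)
  then show ?thesis by simp
qed

lemma expected_queries_reconstruct:
  assumes D: "\<forall>v\<in>V. vdegree E v \<le> D"
  defines "l \<equiv> depth (card V)"
  shows "expected_queries (answer E w) (reconstruct V (max_weight E w))
    \<le> ennreal (layer_count (max_weight E w) * (104 * (l + 1) ^ 3 * (D + 1) ^ 2 * 8 ^ l) + card E)"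
proof -
  let ?J = "layer_count (max_weight E w)"
  let ?R = "reveal_layers V (depth (card V)) ?J {}"
  have V: "V \<noteq> {}" using graph ne by (auto simp: simple_graph_def)
  have res: "fst ` set_pmf (run_alg (answer E w) ?R) \<subseteq> {E}"
    using reveal_layers(1)[OF graph le_power_depth, of w ?J]
      initial_threshold_edges final_threshold_edges by simp
  have "expected_queries (answer E w)
      (bind_alg (weight_table V E) (\<lambda>g. Return (E, \<lambda>e. real_of_ereal (g e)))) = of_nat (card E)"
    using computes_expected_queries[OF computes_weight_table[OF graph w]]
    by (simp add: expected_queries_bind_alg)
  moreover have "expected_queries (answer E w) ?R
      \<le> of_nat ?J * ennreal (104 * (l + 1) ^ 3 * (D + 1) ^ 2 * 8 ^ l)"
    using reveal_layers(2)[OF graph le_power_depth V D, of w ?J] initial_threshold_edges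
    by (simp add: l_def)
  ultimately have "expected_queries (answer E w) (reconstruct V (max_weight E w))
      \<le> of_nat ?J * ennreal (104 * (l + 1) ^ 3 * (D + 1) ^ 2 * 8 ^ l) + of_nat (card E)"
    unfolding reconstruct_def expected_queries_bind_alg[of _ ?R] expect_result_unique[OF res]
    by (simp add: add_mono)
  also have "\<dots> = ennreal (?J * (104 * (l + 1) ^ 3 * (D + 1) ^ 2 * 8 ^ l) + card E)"
    by (simp add: ennreal_of_nat_eq_real_of_nat flip: ennreal_mult ennreal_plus)
  finally show ?thesis .
qed

end

section \<open>Pareto weights\<close>

lemma card_edges_le_square:
  assumes "simple_graph V E"
  shows "card E \<le> card V ^ 2"
proof -
  have V: "finite V" using assms by (simp add: simple_graph_def)
  have "E \<subseteq> (\<lambda>(u, v). {u, v}) ` (V \<times> V)" using assms by (auto simp: simple_graph_def)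
  then have "card E \<le> card (V \<times> V)" using V by (intro surj_card_le) auto
  then show ?thesis by (simp add: card_cartesian_product power2_eq_square)
qed

lemma card_edges_le_degree:
  assumes "simple_graph V E" "\<forall>v\<in>V. vdegree E v \<le> D"
  shows "card E \<le> card V * D"
proof -
  have V: "finite V" using assms by (simp add: simple_graph_def)
  have E: "E = (\<Union>v\<in>V. {e \<in> E. v \<in> e})" using assms(1) by (auto simp: simple_graph_def)
  have "card E \<le> (\<Sum>v\<in>V. vdegree E v)"
    using card_UN_le[OF V, of "\<lambda>v. {e \<in> E. v \<in> e}"] unfolding vdegree_def E[symmetric] .
  also have "\<dots> \<le> (\<Sum>v\<in>V. D)" using assms(2) by (intro sum_mono) auto
  finally show ?thesis by simp
qed

text \<open>The tail at \<open>m powr (2 / \<alpha>)\<close> is \<open>1 / m ^ 2\<close> for each of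
  the \<open>m\<close> edges, and weights below 1 have probability 0; a union bound gives
  \<open>1 / m\<close>.\<close>

lemma pareto_weights_bounded:
  assumes iid: "iid_pareto_weights M \<alpha> E X" and \<alpha>: "0 < \<alpha>" and E: "finite E" "E \<noteq> {}"
  defines "G \<equiv> {\<omega> \<in> space M. \<forall>e\<in>E. 1 \<le> X e \<omega> \<and> X e \<omega> \<le> real (card E) powr (2 / \<alpha>)}"
  shows "G \<in> sets M" "1 - 1 / real (card E) \<le> measure M G"
proof -
  define c where "c = real (card E) powr (2 / \<alpha>)"
  interpret prob_space M using iid by (simp add: iid_pareto_weights_def)
  have X [measurable]: "X e \<in> borel_measurable M" if "e \<in> E" for e
    using iid that by (auto simp: iid_pareto_weights_def indep_vars_def)
  have m: "1 \<le> real (card E)" using E by (simp add: Suc_le_eq card_gt_0_iff)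
  then have c: "1 \<le> c" using \<alpha> by (simp add: c_def ge_one_powr_ge_zero)
  show "G \<in> sets M" unfolding G_def using X E by measurable
  have low: "prob {\<omega> \<in> space M. X e \<omega> < 1} = 0" if "e \<in> E" for e
  proof -
    let ?N = "distr M borel (X e)"
    interpret N: real_distribution ?N using X[OF that] by (rule real_distribution_distr)
    \<comment> \<open>The distribution function vanishes on the interval from 0 to 1, and its left
      limit at 1 is the mass of \<open>{..<1}\<close>.\<close>
    have "eventually (\<lambda>x. cdf ?N x = 0) (at_left 1)"
      using iid that eventually_at_left_field[of _ "1 :: real"]
      by (auto simp: iid_pareto_weights_def pareto_cdf_def intro!: exI[of _ 0])
    then have "(cdf ?N \<longlongrightarrow> 0) (at_left 1)" by (rule tendsto_eventually)
    with N.cdf_at_left[of 1] have "measure ?N {..<1} = 0"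
      by (intro tendsto_unique[OF _ N.cdf_at_left]) simp
    then show ?thesis using X[OF that] by (simp add: measure_distr vimage_def Int_def conj_commute)
  qed
  have high: "prob {\<omega> \<in> space M. c < X e \<omega>} = 1 / real (card E) ^ 2" if "e \<in> E" for e
  proof -
    have "cdf (distr M borel (X e)) c = 1 - c powr (- \<alpha>)"
      using iid that c by (simp add: iid_pareto_weights_def pareto_cdf_def)
    then have "prob {\<omega> \<in> space M. X e \<omega> \<le> c} = 1 - c powr (- \<alpha>)"
      using X[OF that] by (simp add: cdf_def measure_distr vimage_def Int_def conj_commute)
    moreover have "prob {\<omega> \<in> space M. c < X e \<omega>} = 1 - prob {\<omega> \<in> space M. X e \<omega> \<le> c}"
      using X[OF that] by (subst prob_compl[symmetric]) (auto intro!: arg_cong[where f = prob])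
    moreover have "c powr (- \<alpha>) = real (card E) powr (- 2)"
      using \<alpha> by (simp add: c_def powr_powr)
    moreover have "\<dots> = 1 / real (card E) ^ 2"
      using m by (simp add: powr_minus_divide powr_realpow)
    ultimately show ?thesis by simp
  qed
  have "space M - G \<subseteq> (\<Union>e\<in>E. {\<omega> \<in> space M. X e \<omega> < 1} \<union> {\<omega> \<in> space M. c < X e \<omega>})"
    by (auto simp: G_def c_def not_le)
  then have "prob (space M - G) \<le> prob (\<Union>e\<in>E. {\<omega> \<in> space M. X e \<omega> < 1} \<union> {\<omega> \<in> space M. c < X e \<omega>})"
    using X E by (intro finite_measure_mono sets.finite_UN) auto
  also have "\<dots> \<le> (\<Sum>e\<in>E. prob ({\<omega> \<in> space M. X e \<omega> < 1} \<union> {\<omega> \<in> space M. c < X e \<omega>}))"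
    using X E by (intro finite_measure_subadditive_finite) auto
  also have "\<dots> \<le> (\<Sum>e\<in>E. 0 + 1 / real (card E) ^ 2)"
  proof (rule sum_mono)
    fix e assume e: "e \<in> E"
    have "prob ({\<omega> \<in> space M. X e \<omega> < 1} \<union> {\<omega> \<in> space M. c < X e \<omega>})
        \<le> prob {\<omega> \<in> space M. X e \<omega> < 1} + prob {\<omega> \<in> space M. c < X e \<omega>}"
      using X[OF e] by (intro measure_Un_le) auto
    then show "prob ({\<omega> \<in> space M. X e \<omega> < 1} \<union> {\<omega> \<in> space M. c < X e \<omega>})
        \<le> 0 + 1 / real (card E) ^ 2" using low[OF e] high[OF e] by simp
  qed
  also have "\<dots> = 1 / real (card E)" using m by (simp add: power2_eq_square)
  finally show "1 - 1 / real (card E) \<le> prob G" using prob_compl[OF \<open>G \<in> sets M\<close>] by simp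
qed

text \<open>One power of \<open>ln n\<close> comes from the number of layers and three from
  \<open>(l + 1) ^ 3\<close>. The constant is \<open>8 * 104 * 27 * 4 * 8 + 1\<close>: layer count,
  layer bound, \<open>(l + 1) ^ 3\<close>, \<open>(D + 1) ^ 2\<close>, \<open>8 ^ l\<close>, and
  finally the \<open>m\<close> weight queries.\<close>

lemma total_cost_arith:
  fixes n D m :: nat and W \<alpha> :: real
  assumes n: "3 \<le> n" and D: "3 \<le> D" and m: "1 \<le> m" "m \<le> n ^ 2" "m \<le> n * D"
    and W: "1 \<le> W" "W \<le> real m powr (2 / \<alpha>)" and \<alpha>: "0 < \<alpha>"
  shows "real (layer_count W * (104 * (depth n + 1) ^ 3 * (D + 1) ^ 2 * 8 ^ depth n) + m)
    \<le> 718849 * ln n ^ 4 * ((1 + 1 / \<alpha> * ln D) * D ^ 3 * n powr (3 / 2))"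
proof -
  define L where "L = ln (real n)"
  define x where "x = real n powr (3 / 2)"
  define y where "y = 1 + 1 / \<alpha> * ln D"
  define l where "l = depth n"
  \<comment> \<open>Since \<open>exp 1 \<le> 3\<close>, the lower bounds 3 on \<open>n\<close> and
    \<open>D\<close> make both logarithms at least 1, so they can absorb constants.\<close>
  have ln3: "1 \<le> ln (real k)" if "3 \<le> k" for k
    using that exp_le by (subst ln_ge_iff) (auto intro: order_trans)
  have L: "1 \<le> L" unfolding L_def using n by (rule ln3)
  have lnD: "1 \<le> ln (real D)" using D by (rule ln3)
  have y: "1 \<le> y" using \<alpha> lnD by (simp add: y_def)
  have ln2: "1 / 2 \<le> ln (2 :: real)" using ln_le_minus_one[of "1 / 2 :: real"] by (simp add: ln_div)
  have "real (layer_count W) \<le> 1 + log 2 W"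
    using W(1) by (simp add: layer_count_def)
  also have "log 2 W \<le> 2 * ln W"
  proof -
    have "ln W \<le> 2 * ln W * ln 2" using ln2 W(1) mult_left_mono[OF ln2, of "2 * ln W"] by simp
    then show ?thesis using ln2 by (simp add: log_def divide_le_eq)
  qed
  also have "ln W \<le> ln (real m powr (2 / \<alpha>))" using W m(1) by (subst ln_le_cancel_iff) auto
  also have "\<dots> = 2 / \<alpha> * ln (real m)" using m by (simp add: ln_powr)
  also have "ln (real m) \<le> ln (real n ^ 2)"
    using m n by (subst ln_le_cancel_iff) (auto simp flip: of_nat_power)
  also have "ln (real n ^ 2) = 2 * L" using n by (simp add: L_def ln_realpow)
  finally have "real (layer_count W) \<le> 1 + 8 * (1 / \<alpha>) * L" using \<alpha> by (simp add: divide_right_mono)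
  \<comment> \<open>The summand 1 is absorbed by \<open>8 * L\<close>, and
    \<open>1 / \<alpha>\<close> is enlarged by the factor \<open>ln D\<close>, which is at least
    1.\<close>
  also have "\<dots> \<le> 8 * L + 8 * (1 / \<alpha> * ln D) * L"
    using L lnD \<alpha> by (intro add_mono mult_right_mono mult_left_mono) (auto simp: divide_right_mono)
  also have "\<dots> = 8 * L * y" by (simp add: y_def algebra_simps)
  finally have J: "real (layer_count W) \<le> 8 * L * y" .
  have l4: "(4::nat) ^ l < 4 * n" unfolding l_def using n by (intro power_depth_less) simp
  then have l4r: "(4::real) ^ l \<le> 4 * real n"
    by (metis less_imp_le of_nat_le_iff of_nat_mult of_nat_numeral of_nat_power)
  have l: "real (l + 1) \<le> 3 * L"
  proof -
    have ln4: "1 \<le> ln (4 :: real)" using ln3[of 4] by simp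
    have "real l * ln 4 = ln (4 ^ l)" by (simp add: ln_realpow)
    also have "\<dots> \<le> ln (4 * real n)" using l4r n by (subst ln_le_cancel_iff) auto
    also have "\<dots> = ln 4 + L" using n by (simp add: L_def ln_mult)
    finally have "(real l - 1) * ln 4 \<le> L" by (simp add: algebra_simps)
    \<comment> \<open>The maximum with 0 covers \<open>l = 0\<close>, where the factor is
      negative.\<close>
    moreover have "(real l - 1) * 1 \<le> max 0 ((real l - 1) * ln 4)"
      using ln4 mult_left_mono[OF ln4, of "real l - 1"] by (cases "1 \<le> real l") auto
    ultimately have "real l - 1 \<le> L" using L by simp
    then show ?thesis using L by simp
  qed
  have l8: "real (8 ^ l) \<le> 8 * x"
  proof -
    \<comment> \<open>As \<open>8 = 4 powr (3 / 2)\<close>, the bound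
      \<open>4 ^ l \<le> 4 * n\<close> turns into
      \<open>8 ^ l \<le> 8 * n powr (3 / 2)\<close>.\<close>
    have "(4::real) powr (3 / 2) = (2 powr 2) powr (3 / 2)" by (simp add: powr_numeral)
    also have "\<dots> = 8" by (simp only: powr_powr) (simp add: powr_numeral)
    finally have eight: "(4::real) powr (3 / 2) = 8" .
    then have "(8::real) ^ l = (4 powr (3 / 2)) powr real l" by (simp only: powr_realpow)
    also have "\<dots> = (4 powr real l) powr (3 / 2)" by (simp only: powr_powr mult.commute)
    also have "(4::real) powr real l = 4 ^ l" by (rule powr_realpow) simp
    also have "\<dots> powr (3 / 2) \<le> (4 * real n) powr (3 / 2)" using l4r by (intro powr_mono2) auto
    also have "\<dots> = 8 * x" by (simp only: powr_mult x_def eight)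
    finally show ?thesis by simp
  qed
  have D2: "real ((D + 1) ^ 2) \<le> 4 * real D ^ 3"
  proof -
    have "real ((D + 1) ^ 2) \<le> (2 * real D) ^ 2"
      unfolding of_nat_power using D by (intro power_mono) auto
    also have "\<dots> \<le> 4 * real D ^ 3" using D by (simp add: power2_eq_square power3_eq_cube)
    finally show ?thesis .
  qed
  have x: "real n \<le> x" using n powr_mono[of 1 "3 / 2" "real n"] by (simp add: x_def)
  have "real (layer_count W * (104 * (l + 1) ^ 3 * (D + 1) ^ 2 * 8 ^ l)) =
      real (layer_count W) * (104 * real (l + 1) ^ 3 * real ((D + 1) ^ 2) * real (8 ^ l))" by simp
  also have "\<dots> \<le> (8 * L * y) * (104 * (3 * L) ^ 3 * (4 * real D ^ 3) * (8 * x))"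
    using J l D2 l8 L y by (intro mult_mono power_mono) (auto simp: x_def)
  also have "\<dots> = 718848 * (L ^ 4 * (y * real D ^ 3 * x))"
    by (simp add: power_mult_distrib power_eq_if algebra_simps)
  finally have 1: "real (layer_count W * (104 * (l + 1) ^ 3 * (D + 1) ^ 2 * 8 ^ l))
    \<le> 718848 * (L ^ 4 * (y * real D ^ 3 * x))" .
  have "real m \<le> real n * real D" using m(3) by (metis of_nat_le_iff of_nat_mult)
  also have "\<dots> \<le> x * (real D ^ 3)"
    using x D self_le_power[of "real D" 3] by (intro mult_mono) auto
  also have "\<dots> \<le> L ^ 4 * (y * real D ^ 3 * x)"
  proof -
    have "1 * (1 * real D ^ 3 * x) \<le> L ^ 4 * (y * real D ^ 3 * x)"
      using L y by (intro mult_mono one_le_power) (auto simp: x_def)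
    then show ?thesis by (simp add: mult.commute)
  qed
  finally have "real (layer_count W * (104 * (l + 1) ^ 3 * (D + 1) ^ 2 * 8 ^ l) + m)
    \<le> 718849 * (L ^ 4 * (y * real D ^ 3 * x))"
    using 1 unfolding of_nat_add by linarith
  then show ?thesis by (simp add: L_def y_def x_def l_def mult.assoc)
qed

text \<open>The algorithm is fixed before the graph and sees only \<open>V\<close> and the maximum
  weight. Correctness concerns every outcome of the internal randomness; only the cost bound is
  asymptotic. \<open>C\<close> and \<open>k\<close> precede \<alpha>, so they are uniform in it.
  \<open>E \<noteq> {}\<close> ensures that the maximum weight is meaningful.\<close>

theorem theorem2:
  "\<exists>(alg :: 'v set \<Rightarrow> real \<Rightarrow> ('v, 'v set set \<times> ('v set \<Rightarrow> real)) query_alg) (C :: real) (k :: nat).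
     (\<forall>V W. finite V \<longrightarrow> legal_alg V (alg V W)) \<and>
     (\<forall>V E w. simple_graph V E \<and> E \<noteq> {} \<and> (\<forall>e\<in>E. 1 \<le> w e) \<longrightarrow>
        (\<forall>((E', w'), c) \<in> set_pmf (run_alg (answer E w) (alg V (max_weight E w))).
           E' = E \<and> (\<forall>e\<in>E. w' e = w e))) \<and>
     (\<forall>(\<alpha> :: real) (V :: nat \<Rightarrow> 'v set) (E :: nat \<Rightarrow> 'v set set)
        (M :: nat \<Rightarrow> 'a measure) (X :: nat \<Rightarrow> 'v set \<Rightarrow> 'a \<Rightarrow> real).
        \<alpha> > 0 \<and>
        (\<forall>i. simple_graph (V i) (E i)) \<and>
        (\<forall>i. iid_pareto_weights (M i) \<alpha> (E i) (X i)) \<and>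
        filterlim (\<lambda>i. card (V i)) at_top sequentially \<and>
        filterlim (\<lambda>i. max_degree (V i) (E i)) at_top sequentially \<and>
        filterlim (\<lambda>i. real (card (E i)) / real (max_degree (V i) (E i))) at_top sequentially \<longrightarrow>
        asymptotically_almost_surely M (\<lambda>i \<omega>.
          let n = real (card (V i)); D = real (max_degree (V i) (E i)); w = (\<lambda>e. X i e \<omega>) in
          expected_queries (answer (E i) w) (alg (V i) (max_weight (E i) w))
            \<le> ennreal (C * ln n ^ k * ((1 + 1 / \<alpha> * ln D) * D ^ 3 * n powr (3 / 2)))))"
proof (intro exI conjI allI impI)
  show "finite V \<Longrightarrow> legal_alg V (reconstruct V W)" for V :: "'v set" and W
    by (rule legal_reconstruct)
next
  fix V :: "'v set" and E and w :: "'v set \<Rightarrow> real"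
  assume "simple_graph V E \<and> E \<noteq> {} \<and> (\<forall>e\<in>E. 1 \<le> w e)"
  then show "\<forall>((E', w'), c) \<in> set_pmf (run_alg (answer E w) (reconstruct V (max_weight E w))).
      E' = E \<and> (\<forall>e\<in>E. w' e = w e)"
    using results_reconstruct[of V E w] by force
next
  fix \<alpha> :: real and V :: "nat \<Rightarrow> 'v set" and E :: "nat \<Rightarrow> 'v set set"
    and M :: "nat \<Rightarrow> 'a measure" and X :: "nat \<Rightarrow> 'v set \<Rightarrow> 'a \<Rightarrow> real"
  let ?n = "\<lambda>i. card (V i)" and ?D = "\<lambda>i. max_degree (V i) (E i)" and ?m = "\<lambda>i. card (E i)"
  assume asm: "\<alpha> > 0 \<and> (\<forall>i. simple_graph (V i) (E i)) \<and>
        (\<forall>i. iid_pareto_weights (M i) \<alpha> (E i) (X i)) \<and>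
        filterlim ?n at_top sequentially \<and> filterlim ?D at_top sequentially \<and>
        filterlim (\<lambda>i. real (?m i) / real (?D i)) at_top sequentially"
  then have \<alpha>: "0 < \<alpha>" and graph: "\<And>i. simple_graph (V i) (E i)"
    and iid: "\<And>i. iid_pareto_weights (M i) \<alpha> (E i) (X i)" by auto
  have fin: "finite (V i)" "finite (E i)" for i
    using graph[of i] finite_pairs[of "V i"] by (auto simp: simple_graph_def intro: finite_subset)
  define large where "large i \<longleftrightarrow> 3 \<le> ?n i \<and> 3 \<le> ?D i \<and> E i \<noteq> {}" for i
  define G where "G i = {\<omega> \<in> space (M i). \<forall>e\<in>E i. 1 \<le> X i e \<omega> \<and> X i e \<omega> \<le> real (?m i) powr (2 / \<alpha>)}" for i
  \<comment> \<open>For the finitely many small indices the event is taken to be empty, which does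
    not affect the limit.\<close>
  define A where "A i = (if large i then G i else {})" for i
  have G: "G i \<in> sets (M i)" "1 - 1 / real (?m i) \<le> measure (M i) (G i)" if "large i" for i
    using pareto_weights_bounded[OF iid \<alpha> fin(2)] that by (auto simp: G_def large_def)
  have evD: "eventually (\<lambda>i. 3 \<le> ?D i) sequentially" and "eventually (\<lambda>i. 3 \<le> ?n i) sequentially"
    and "eventually (\<lambda>i. 1 \<le> real (?m i) / real (?D i)) sequentially"
    using asm by (auto simp: filterlim_at_top)
  then have large: "eventually large sequentially"
    by eventually_elim (auto simp: large_def)
  \<comment> \<open>Eventually \<open>D \<ge> 1\<close>, so \<open>m\<close> dominates
    \<open>m / D\<close> and tends to infinity with it; hence the failure probability
    \<open>1 / m\<close> vanishes.\<close>
  have "filterlim (\<lambda>i. real (?m i)) at_top sequentially"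
  proof (rule filterlim_at_top_mono)
    show "filterlim (\<lambda>i. real (?m i) / real (?D i)) at_top sequentially" using asm by blast
    show "eventually (\<lambda>i. real (?m i) / real (?D i) \<le> real (?m i)) sequentially"
      using evD by eventually_elim (simp add: divide_le_eq mult_le_cancel_left1)
  qed
  then have lim: "(\<lambda>i. 1 - 1 / real (?m i)) \<longlonglongrightarrow> 1 - 0"
    by (intro tendsto_diff tendsto_const tendsto_divide_0[OF tendsto_const]
        filterlim_at_top_imp_at_infinity)
  have "(\<lambda>i. measure (M i) (A i)) \<longlonglongrightarrow> 1"
  proof (rule tendsto_sandwich[OF _ _ lim[simplified] tendsto_const])
    show "eventually (\<lambda>i. 1 - 1 / real (?m i) \<le> measure (M i) (A i)) sequentially"
      using large by eventually_elim (simp add: A_def G(2))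
    show "eventually (\<lambda>i. measure (M i) (A i) \<le> 1) sequentially"
      using iid by (intro always_eventually allI prob_space.prob_le_1) (simp add: iid_pareto_weights_def)
  qed
  moreover have "A i \<in> sets (M i)" for i using G(1) by (simp add: A_def)
  moreover have "let n = real (?n i); D = real (?D i); w = (\<lambda>e. X i e \<omega>) in
      expected_queries (answer (E i) w) (reconstruct (V i) (max_weight (E i) w))
        \<le> ennreal (718849 * ln n ^ 4 * ((1 + 1 / \<alpha> * ln D) * D ^ 3 * n powr (3 / 2)))"
    if "\<omega> \<in> A i" for i \<omega>
  proof -
    define w where "w = (\<lambda>e. X i e \<omega>)"
    have i: "large i" and \<omega>: "\<omega> \<in> G i" using that by (auto simp: A_def split: if_splits)
    then have ne: "E i \<noteq> {}" and w: "\<forall>e\<in>E i. 1 \<le> w e"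
      by (auto simp: large_def G_def w_def)
    have D: "\<forall>v\<in>V i. vdegree (E i) v \<le> ?D i" using fin by (auto simp: max_degree_def)
    have "max_weight (E i) w \<le> real (?m i) powr (2 / \<alpha>)"
      using \<omega> fin(2) ne by (auto simp: max_weight_def w_def G_def)
    moreover have "1 \<le> ?m i" using ne fin(2) by (simp add: Suc_le_eq card_gt_0_iff)
    ultimately have "real (layer_count (max_weight (E i) w) *
        (104 * (depth (?n i) + 1) ^ 3 * (?D i + 1) ^ 2 * 8 ^ depth (?n i)) + ?m i)
      \<le> 718849 * ln (?n i) ^ 4 * ((1 + 1 / \<alpha> * ln (?D i)) * ?D i ^ 3 * ?n i powr (3 / 2))"
      using i \<alpha> card_edges_le_square[OF graph] card_edges_le_degree[OF graph D]
        max_weight_ge_one[OF graph ne w]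
      by (intro total_cost_arith) (auto simp: large_def)
    from order_trans[OF expected_queries_reconstruct[OF graph ne w D] ennreal_leI[OF this]]
    show ?thesis by (simp add: Let_def w_def)
  qed
  ultimately show "asymptotically_almost_surely M (\<lambda>i \<omega>.
      let n = real (?n i); D = real (?D i); w = (\<lambda>e. X i e \<omega>) in
      expected_queries (answer (E i) w) (reconstruct (V i) (max_weight (E i) w))
        \<le> ennreal (718849 * ln n ^ 4 * ((1 + 1 / \<alpha> * ln D) * D ^ 3 * n powr (3 / 2))))"
    unfolding asymptotically_almost_surely_def by (intro exI[of _ A]) blast
qed

end
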